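(* We have \[ \Phi_{\sqcup\!\sqcup}^{S}(T_{1},T_{2})=\left.\frac{d}{dT}\Phi^{L}(T)\right|_{T=-T_{1}+T_{2}},\qquad \Phi_{*}^{S}(T_{1},T_{2})=\frac{\Phi^{L}(\pi i-T_{1}+T_{2})-\Phi^{L}(-\pi i-T_{1}+T_{2})}{2\pi i}, \] \[ \Phi^{RS}=\frac{\Phi^{L}(2\pi i)-\Phi^{L}(0)}{2\pi i}=\frac{\Phi^{L}(2\pi i)-1}{2\pi i},\qquad \Phi^{RS}=\frac{1}{2\pi i}\int_{0}^{2\pi i}\Phi_{\sqcup\!\sqcup}^{S}(0,T)dT,\qquad \Phi^{RS}=\Phi_{*}^{S}\left(-\frac{\pi i}{2},\frac{\pi i}{2}\right). \]
   Context: Regularized iterated integrals: $I_{\Gamma}(x;a_{1},\dots,a_{n};y)$ is the constant term $c_0$ of the expansion $\int_{t<t_{1}<\cdots<t_{n}<1-t}\prod_{j}\frac{d\gamma(t_{j})}{\gamma(t_{j})-a_{j}}=\sum_{k}c_{k}(\log t)^{k}+O(t\log^{n+1}t)$, $t\to0$. Let $0'$ be the tangential base point at $0$ with tangent $1$, $1'$ at $1$ with tangent $-1$; on $\mathbb{C}\setminus\{0,1\}$ let ${\rm dch}$ be the straight path $0'\to1'$, $\alpha$ the loop at $1'$ circling $1$ once counterclockwise, $\beta={\rm dch}\cdot\alpha\cdot{\rm dch}^{-1}$, and $\beta_{n}={\rm dch}\cdot\alpha^{n}\cdot{\rm dch}^{-1}$ for $n\in\mathbb{Z}$. Define $L_{n}(e_{a_{1}}\cdots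 e_{a_{k}}):=I_{\beta_{n}}(0';a_{1},\dots,a_{k};0')$ and let $L(w;T)\in\mathbb{C}[T]$ be the unique polynomial with $L_{n}(w)=L(w;2\pi in)$ for all $n$. Let $Z^{RS}(e_{a_{1}}\cdots e_{a_{k}})=\frac{1}{2\pi i}I_{\beta}(0';a_{1},\dots,a_{k};0')$ for $k\ge1$. Let $R=\mathbb{Q}\langle\langle X_{0},X_{1}\rangle\rangle$ (coefficients extended to $\mathbb{C}$), $\epsilon$ the anti-automorphism with $\epsilon(X_{a})=-X_{a}$, $\Gamma_{1}(t)=\exp(\sum_{k\ge2}\frac{\zeta(k)}{k}(-t)^{k})$. Set $\Phi_{\sqcup\!\sqcup}(T):=\sum_{k\ge0}\sum_{a_i\in\{0,1\}}I_{{\rm dch}}(0';a_{1},\dots,a_{k};1')X_{a_{1}}\cdots X_{a_{k}}\exp(-TX_{1})$, $\Phi_{*}(T):=\Phi_{\sqcup\!\sqcup}(T)\Gamma_{1}(-X_{1})^{-1}$, $\Phi_{\sqcup\!\sqcup}^{S}(T_{1},T_{2}):=\Phi_{\sqcup\!\sqcup}(T_{1})X_{1}\epsilon(\Phi_{\sqcup\!\sqcup}(T_{2}))$, $\Phi_{*}^{S}(T_{1},T_{2}):=\Phi_{*}(T_{1})X_{1}\epsilon(\Phi_{*}(T_{2}))$, $\Phi^{RS}:=\sum_{k\ge1}\sum_{a_i}Z^{RS}(e_{a_{1}}\cdots e_{a_{k}})X_{a_{1}}\cdots X_{a_{k}}$, $\Phi^{L}(T):=\sum_{k\ge0}\sum_{a_i}L(e_{a_{1}}\cdots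 e_{a_{k}};T)X_{a_{1}}\cdots X_{a_{k}}$. *)

theory Defs
  imports
    "HOL-Complex_Analysis.Complex_Analysis"
    "HOL-Library.Landau_Symbols"
begin

section \<open>Paths between tangential base points of the plane minus 0 and 1\<close>

text \<open>A tangential base point is a pair of a point and a nonzero tangent vector at it.  A path
  from \<open>(x, v)\<close> to \<open>(y, w)\<close> is a path \<open>g\<close> on \<open>[0,1]\<close> from \<open>x\<close> to \<open>y\<close>, inside the plane minus
  0 and 1 except at its end points, with \<open>g'(0) = v\<close> and \<open>g'(1) = - w\<close>.  Every homotopy class
  of such paths between the base points used here has a representative whose first and last
  quarters run straight along the tangent vectors; only such representatives are used.  Regularized iterated integrals depend on the class alone.\<close>

definition tangential_path :: "complex \<times> complex \<Rightarrow> (real \<Rightarrow> complex) \<Rightarrow> complex \<times> complex \<Rightarrow> bool" where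
  "tangential_path x g y \<longleftrightarrow> valid_path g \<and>
     (\<forall>t\<in>{0..1/4}. g t = fst x + of_real t * snd x) \<and>
     (\<forall>t\<in>{3/4..1}. g t = fst y + of_real (1 - t) * snd y) \<and>
     (\<forall>t\<in>{0<..<1}. g t \<notin> {0, 1})"

definition base0 :: "complex \<times> complex" where "base0 = (0, 1)"
definition base1 :: "complex \<times> complex" where "base1 = (1, -1)"

definition tangential_close ::
    "complex \<times> complex \<Rightarrow> (real \<Rightarrow> complex) \<Rightarrow> complex \<times> complex \<Rightarrow> real \<Rightarrow> complex" where
  "tangential_close x p y = (\<lambda>t.
     if t \<le> 1/4 then fst x + of_real t * snd x
     else if t \<le> 3/4 then p (2 * t - 1/2)
     else fst y + of_real (1 - t) * snd y)"

text \<open>Composition of \<open>g\<close> from \<open>x\<close> to \<open>(y, w)\<close> with \<open>h\<close> from \<open>(y, w)\<close> to \<open>z\<close> (first \<open>g\<close>, then \<open>h\<close>).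
  The puncture \<open>y\<close> is not passed through: \<open>g\<close> is left when it reaches \<open>y + w/4\<close>, at
  time 3/4, and \<open>h\<close> is entered at that same point, at time 1/4.\<close>

definition tangential_join :: "complex \<times> complex \<Rightarrow> (real \<Rightarrow> complex) \<Rightarrow> (real \<Rightarrow> complex) \<Rightarrow>
    complex \<times> complex \<Rightarrow> real \<Rightarrow> complex" where
  "tangential_join x g h z =
     tangential_close x (subpath (1/4) (3/4) g +++ subpath (1/4) (3/4) h) z"

definition tangential_trivial :: "complex \<times> complex \<Rightarrow> real \<Rightarrow> complex" where
  "tangential_trivial y = tangential_close y (\<lambda>_. fst y + snd y / 4) y"

definition loop_power :: "complex \<times> complex \<Rightarrow> (real \<Rightarrow> complex) \<Rightarrow> int \<Rightarrow> real \<Rightarrow> complex" where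
  "loop_power y g n =
     ((\<lambda>h. tangential_join y h (if 0 \<le> n then g else reversepath g) y) ^^ nat \<bar>n\<bar>)
       (tangential_trivial y)"

definition dch :: "real \<Rightarrow> complex" where
  "dch = linepath 0 1"

definition loop_alpha :: "real \<Rightarrow> complex" where
  "loop_alpha = tangential_close base1 (part_circlepath 1 (1/4) pi (3 * pi)) base1"

definition loop_beta :: "real \<Rightarrow> complex" where
  "loop_beta = tangential_join base0 (tangential_join base0 dch loop_alpha base1) (reversepath dch) base0"

definition loop_beta_n :: "int \<Rightarrow> real \<Rightarrow> complex" where
  "loop_beta_n n = tangential_join base0
     (tangential_join base0 dch (loop_power base1 loop_alpha n) base1) (reversepath dch) base0"

text \<open>The facts up to the end of this section confirm that these are paths of the claimed type.\<close>

lemma tangential_pathD: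
  assumes "tangential_path x g y"
  shows "valid_path g" "\<And>t. 0 \<le> t \<Longrightarrow> t \<le> 1/4 \<Longrightarrow> g t = fst x + of_real t * snd x"
    "\<And>t. 3/4 \<le> t \<Longrightarrow> t \<le> 1 \<Longrightarrow> g t = fst y + of_real (1 - t) * snd y"
    "\<And>t. 0 < t \<Longrightarrow> t < 1 \<Longrightarrow> g t \<noteq> 0 \<and> g t \<noteq> 1"
  using assms by (auto simp: tangential_path_def)

lemma tangential_path_close:
  assumes p: "valid_path p" "path_image p \<inter> {0, 1} = {}"
    and ends: "pathstart p = fst x + snd x / 4" "pathfinish p = fst y + snd y / 4"
    and xy: "x \<in> {base0, base1}" "y \<in> {base0, base1}"
  shows "tangential_path x (tangential_close x p y) y"
proof -
  have C1: "(\<lambda>t. a + of_real t * b) piecewise_C1_differentiable_on S"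
    "(\<lambda>t. a + of_real (1 - t) * b) piecewise_C1_differentiable_on S" for a b :: complex and S
    by (auto intro!: C1_differentiable_imp_piecewise derivative_intros simp: C1_differentiable_on_eq)
  have mid: "(\<lambda>t. p (2 * t - 1/2)) piecewise_C1_differentiable_on {1/4..3/4}"
  proof -
    have "(\<lambda>t::real. 2 * t + (- 1/2)) ` {1/4..3/4} = {0..1}"
      by (subst image_affinity_atLeastAtMost) auto
    with p(1) have "p piecewise_C1_differentiable_on ((\<lambda>t. 2 * t + (- 1/2)) ` {1/4..3/4})"
      by (simp add: valid_path_def)
    from piecewise_C1_differentiable_affine[OF this] show ?thesis
      by (simp add: o_def)
  qed
  have p01: "p 0 = fst x + snd x / 4" "p 1 = fst y + snd y / 4"
    using ends by (auto simp: pathstart_def pathfinish_def)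
  have "valid_path (tangential_close x p y)"
    unfolding valid_path_def tangential_close_def
    by (intro piecewise_C1_differentiable_cases C1 mid) (auto simp: p01)
  moreover have "tangential_close x p y t = fst y + of_real (1 - t) * snd y" if "3/4 \<le> t" for t
  proof (cases "t = 3/4")
    case True
    have "tangential_close x p y (3/4) = p 1" by (simp add: tangential_close_def)
    then show ?thesis unfolding True by (simp add: p01)
  qed (use that in \<open>auto simp: tangential_close_def\<close>)
  moreover have "tangential_close x p y t \<notin> {0, 1}" if t: "0 < t" "t < 1" for t
  proof -
    consider "t \<le> 1/4" | "1/4 < t" "t \<le> 3/4" | "3/4 < t" by linarith
    then show ?thesis
    proof cases
      case 1
      with t xy show ?thesis
        by (auto simp: tangential_close_def base0_def base1_def complex_eq_iff)
    next
      case 2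
      then have "p (2 * t - 1/2) \<in> path_image p" by (auto simp: path_image_def)
      with p(2) have "p (2 * t - 1/2) \<notin> {0, 1}" by blast
      with 2 show ?thesis by (simp add: tangential_close_def)
    next
      case 3
      with t xy show ?thesis
        by (auto simp: tangential_close_def base0_def base1_def complex_eq_iff)
    qed
  qed
  moreover have "tangential_close x p y t = fst x + of_real t * snd x" if "t \<le> 1/4" for t
    using that by (simp add: tangential_close_def)
  ultimately show ?thesis
    unfolding tangential_path_def by (metis atLeastAtMost_iff greaterThanLessThan_iff)
qed

lemma tangential_path_join:
  assumes g: "tangential_path x g y" and h: "tangential_path y h z"
    and xz: "x \<in> {base0, base1}" "z \<in> {base0, base1}"
  shows "tangential_path x (tangential_join x g h z) z"
  unfolding tangential_join_def
proof (rule tangential_path_close)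
  note G = tangential_pathD[OF g] and H = tangential_pathD[OF h]
  show "valid_path (subpath (1/4) (3/4) g +++ subpath (1/4) (3/4) h)"
    using G(1) H(1) G(3)[of "3/4"] H(2)[of "1/4"]
    by (intro valid_path_join valid_path_subpath) simp_all
  have avoid: "path_image (subpath (1/4) (3/4) k) \<inter> {0, 1} = {}"
    if *: "\<And>t. 0 < t \<Longrightarrow> t < 1 \<Longrightarrow> k t \<noteq> 0 \<and> k t \<noteq> (1::complex)" for k :: "real \<Rightarrow> complex"
  proof -
    have "z \<notin> {0, 1}" if "z \<in> path_image (subpath (1/4) (3/4) k)" for z
    proof -
      from that obtain s where "s \<in> {1/4..3/4}" "z = k s"
        by (auto simp: path_image_subpath)
      with *[of s] show ?thesis by simp
    qed
    then show ?thesis by (simp only: disjoint_iff) simp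
  qed
  have "path_image (subpath (1/4) (3/4) g) \<inter> {0, 1} = {}"
    by (rule avoid) (rule G(4))
  moreover have "path_image (subpath (1/4) (3/4) h) \<inter> {0, 1} = {}"
    by (rule avoid) (rule H(4))
  ultimately show "path_image (subpath (1/4) (3/4) g +++ subpath (1/4) (3/4) h) \<inter> {0, 1} = {}"
    using path_image_join_subset[of "subpath (1/4) (3/4) g" "subpath (1/4) (3/4) h"] by blast
  show "pathstart (subpath (1/4) (3/4) g +++ subpath (1/4) (3/4) h) = fst x + snd x / 4"
    using G(2)[of "1/4"] by simp
  show "pathfinish (subpath (1/4) (3/4) g +++ subpath (1/4) (3/4) h) = fst z + snd z / 4"
    using H(3)[of "3/4"] by simp
qed (use xz in auto)

lemma tangential_path_reverse:
  assumes "tangential_path x g y"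
  shows "tangential_path y (reversepath g) x"
proof -
  note G = tangential_pathD[OF assms]
  show ?thesis
    unfolding tangential_path_def reversepath_def
    using G(2-4) valid_path_imp_reverse[OF G(1)] by (auto simp: reversepath_def)
qed

lemma tangential_path_trivial:
  assumes "y \<in> {base0, base1}"
  shows "tangential_path y (tangential_trivial y) y"
  unfolding tangential_trivial_def
proof (rule tangential_path_close)
  show "valid_path (\<lambda>_. fst y + snd y / 4)"
    unfolding valid_path_def by (rule C1_differentiable_imp_piecewise) simp
qed (use assms in \<open>auto simp: pathstart_def pathfinish_def path_image_def base0_def base1_def\<close>)

lemma tangential_path_dch: "tangential_path base0 dch base1"
proof -
  have "dch t = of_real t" for t
    by (simp add: dch_def linepath_def scaleR_conv_of_real)
  moreover have "valid_path dch" by (simp add: dch_def)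
  ultimately show ?thesis
    by (simp add: tangential_path_def base0_def base1_def)
qed

lemma tangential_path_alpha: "tangential_path base1 loop_alpha base1"
  unfolding loop_alpha_def
proof (rule tangential_path_close)
  have "\<i> * complex_of_real (3 * pi) = of_real pi * \<i> + 2 * of_real pi * \<i>"
    by simp
  then have "exp (\<i> * complex_of_real (3 * pi)) = - 1"
    by (simp only: exp_add exp_two_pi_i exp_pi_i mult_1_right)
  then show "pathfinish (part_circlepath 1 (1/4) pi (3 * pi)) = fst base1 + snd base1 / 4"
    by (simp only: pathfinish_part_circlepath) (simp add: base1_def)
  have "dist 1 z = 1/4" if "z \<in> path_image (part_circlepath 1 (1/4) pi (3 * pi))" for z
    using that by (auto simp: path_image_def part_circlepath_def dist_norm norm_mult)
  from this[of 0] this[of 1]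
  show "path_image (part_circlepath 1 (1/4) pi (3 * pi)) \<inter> {0, 1} = {}"
    by auto
  have "exp (\<i> * complex_of_real pi) = - 1"
    by (simp only: mult.commute[of \<i>] exp_pi_i)
  then show "pathstart (part_circlepath 1 (1/4) pi (3 * pi)) = fst base1 + snd base1 / 4"
    by (simp only: pathstart_part_circlepath) (simp add: base1_def)
qed auto

lemma tangential_path_power:
  assumes y: "y \<in> {base0, base1}" and g: "tangential_path y g y"
  shows "tangential_path y (loop_power y g n) y"
proof -
  define h where "h = (if 0 \<le> n then g else reversepath g)"
  have h: "tangential_path y h y"
    using g tangential_path_reverse[OF g] by (simp add: h_def)
  have "tangential_path y (((\<lambda>k. tangential_join y k h y) ^^ m) (tangential_trivial y)) y" for m
  proof (induction m)
    case 0
    show ?case using tangential_path_trivial[OF y] by simp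
  next
    case (Suc m)
    show ?case using tangential_path_join[OF Suc h y y] by simp
  qed
  then show ?thesis by (simp add: loop_power_def h_def)
qed

lemma tangential_path_beta: "tangential_path base0 loop_beta base0"
  unfolding loop_beta_def
  by (intro tangential_path_join[where y = base1] tangential_path_reverse tangential_path_dch
        tangential_path_alpha) auto

lemma tangential_path_beta_n: "tangential_path base0 (loop_beta_n n) base0"
  unfolding loop_beta_n_def
  by (intro tangential_path_join[where y = base1] tangential_path_reverse tangential_path_dch
        tangential_path_power tangential_path_alpha) auto


section \<open>Regularized iterated integrals\<close>

text \<open>The integral over \<open>s < t\<^sub>1 < \<dots> < t\<^sub>n < u\<close>; the outermost integration is over \<open>t\<^sub>1\<close>.\<close>

primrec iterated_integral :: "(real \<Rightarrow> complex) \<Rightarrow> complex list \<Rightarrow> real \<Rightarrow> real \<Rightarrow> complex" where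
  "iterated_integral g [] s u = 1"
| "iterated_integral g (a # as) s u =
     integral {s..u} (\<lambda>t. vector_derivative g (at t) / (g t - a) * iterated_integral g as t u)"

definition has_log_expansion :: "nat \<Rightarrow> (real \<Rightarrow> complex) \<Rightarrow> (nat \<Rightarrow> complex) \<Rightarrow> bool" where
  "has_log_expansion n f c \<longleftrightarrow>
     (\<lambda>t. f t - (\<Sum>k\<le>n. c k * of_real (ln t ^ k)))
       \<in> O[at_right 0](\<lambda>t. of_real (t * ln t ^ (n + 1)))"

text \<open>The base points are determined by the path and hence not arguments.\<close>

definition reg_integral :: "(real \<Rightarrow> complex) \<Rightarrow> complex list \<Rightarrow> complex" where
  "reg_integral g as =
     (THE c0. \<exists>c. has_log_expansion (length as) (\<lambda>t. iterated_integral g as t (1 - t)) c \<and> c 0 = c0)"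


section \<open>Formal power series in two noncommuting variables\<close>

text \<open>Words over \<open>{0,1}\<close> are lists of type \<^typ>\<open>bool list\<close>, with \<^const>\<open>False\<close> for 0 and
  \<^const>\<open>True\<close> for 1.\<close>

typedef 'a ncps = "UNIV :: (bool list \<Rightarrow> 'a) set"
  morphisms nc_coeff Abs_ncps ..

lemma nc_coeff_Abs [simp]: "nc_coeff (Abs_ncps f) = f"
  by (simp add: Abs_ncps_inverse)

lemma ncps_eqI: "(\<And>w. nc_coeff f w = nc_coeff g w) \<Longrightarrow> f = g"
  by (rule nc_coeff_inject[THEN iffD1]) (rule ext)

instantiation ncps :: (ring_1) ring_1
begin

definition "0 = Abs_ncps (\<lambda>w. 0)"
definition "1 = Abs_ncps (\<lambda>w. if w = [] then 1 else 0)"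
definition "f + g = Abs_ncps (\<lambda>w. nc_coeff f w + nc_coeff g w)"
definition "f - g = Abs_ncps (\<lambda>w. nc_coeff f w - nc_coeff g w)"
definition "- f = Abs_ncps (\<lambda>w. - nc_coeff f w)"
definition
  "f * g = Abs_ncps (\<lambda>w. \<Sum>k=0..length w. nc_coeff f (take k w) * nc_coeff g (drop k w))"

instance
proof
  fix f g h :: "'a ncps"
  show "f * g * h = f * (g * h)"
  proof (rule ncps_eqI)
    fix w :: "bool list"
    let ?n = "length w"
    define F where "F i j (l::nat) =
      nc_coeff f (take i w) * nc_coeff g (take j (drop i w)) * nc_coeff h (drop (i + j) w)" for i j l
    have "nc_coeff (f * g * h) w = (\<Sum>j=0..?n. \<Sum>i=0..j. F i (j - i) (?n - j))"
      by (auto simp: times_ncps_def F_def sum_distrib_right drop_take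
               intro!: sum.cong)
    also have "\<dots> = (\<Sum>j=0..?n. \<Sum>i=0..?n - j. F j i (?n - j - i))"
      by (rule fps_mult_assoc_lemma)
    also have "\<dots> = nc_coeff (f * (g * h)) w"
      by (auto simp: times_ncps_def F_def sum_distrib_left mult.assoc add.commute intro!: sum.cong)
    finally show "nc_coeff (f * g * h) w = nc_coeff (f * (g * h)) w" .
  qed
  show "1 * f = f"
  proof (rule ncps_eqI)
    fix w
    have "nc_coeff (1 * f) w = (\<Sum>k=0..length w. if k = 0 then nc_coeff f w else 0)"
      unfolding times_ncps_def one_ncps_def nc_coeff_Abs
      by (rule sum.cong) auto
    then show "nc_coeff (1 * f) w = nc_coeff f w" by simp
  qed
  show "f * 1 = f"
  proof (rule ncps_eqI)
    fix w
    have "nc_coeff (f * 1) w = (\<Sum>k=0..length w. if k = length w then nc_coeff f w else 0)"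
      unfolding times_ncps_def one_ncps_def nc_coeff_Abs
      by (rule sum.cong) auto
    then show "nc_coeff (f * 1) w = nc_coeff f w" by simp
  qed
  show "(0::'a ncps) \<noteq> 1"
    by (auto simp: zero_ncps_def one_ncps_def Abs_ncps_inject dest: fun_cong[where x = "[]"])
qed (auto simp: zero_ncps_def plus_ncps_def minus_ncps_def uminus_ncps_def times_ncps_def
                algebra_simps sum.distrib nc_coeff_inverse intro!: ncps_eqI)

end

definition nc_scale :: "'a \<Rightarrow> 'a ncps \<Rightarrow> 'a::ring_1 ncps" where
  "nc_scale c f = Abs_ncps (\<lambda>w. c * nc_coeff f w)"

definition nc_var :: "bool \<Rightarrow> 'a::ring_1 ncps" where
  "nc_var a = Abs_ncps (\<lambda>w. if w = [a] then 1 else 0)"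

text \<open>The value of a series in one variable at the noncommuting variable with index \<open>a\<close>.\<close>

definition fps_at_var :: "'a fps \<Rightarrow> bool \<Rightarrow> 'a::ring_1 ncps" where
  "fps_at_var f a = Abs_ncps (\<lambda>w. if set w \<subseteq> {a} then fps_nth f (length w) else 0)"

text \<open>The continuous anti-automorphism with \<open>X\<^sub>a \<mapsto> - X\<^sub>a\<close>.\<close>

definition nc_eps :: "'a ncps \<Rightarrow> 'a::ring_1 ncps" where
  "nc_eps f = Abs_ncps (\<lambda>w. (-1) ^ length w * nc_coeff f (rev w))"

lemma nc_eps_var: "nc_eps (nc_var a) = - nc_var a"
  by (auto simp: nc_eps_def nc_var_def uminus_ncps_def rev_swap intro!: ncps_eqI)

lemma nc_eps_add: "nc_eps (f + g) = nc_eps f + nc_eps g"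
  by (auto simp: nc_eps_def plus_ncps_def distrib_left intro!: ncps_eqI)

lemma nc_eps_one: "nc_eps 1 = 1"
  by (auto simp: nc_eps_def one_ncps_def intro!: ncps_eqI)

lemma nc_eps_mult:
  fixes f g :: "'a::comm_ring_1 ncps"
  shows "nc_eps (f * g) = nc_eps g * nc_eps f"
proof (rule ncps_eqI)
  fix w :: "bool list"
  let ?n = "length w"
  have "nc_coeff (nc_eps (f * g)) w =
    (\<Sum>k=0..?n. (-1) ^ ?n * (nc_coeff f (take k (rev w)) * nc_coeff g (drop k (rev w))))"
    by (simp add: nc_eps_def times_ncps_def sum_distrib_left)
  also have "\<dots> = (\<Sum>k=0..?n. (-1) ^ ?n *
      (nc_coeff f (take (?n - k) (rev w)) * nc_coeff g (drop (?n - k) (rev w))))"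
    by (rule sum.reindex_bij_witness[where i = "\<lambda>k. ?n - k" and j = "\<lambda>k. ?n - k"]) auto
  also have "\<dots> = nc_coeff (nc_eps g * nc_eps f) w"
    unfolding times_ncps_def nc_eps_def nc_coeff_Abs
  proof (rule sum.cong)
    fix k assume k: "k \<in> {0..?n}"
    then have "(-1::'a) ^ ?n = (-1) ^ k * (-1) ^ (?n - k)"
      by (simp flip: power_add)
    with k show "(-1) ^ ?n * (nc_coeff f (take (?n - k) (rev w)) * nc_coeff g (drop (?n - k) (rev w))) =
      (-1) ^ length (take k w) * nc_coeff g (rev (take k w)) *
      ((-1) ^ length (drop k w) * nc_coeff f (rev (drop k w)))"
      by (simp add: rev_take rev_drop mult_ac)
  qed simp
  finally show "nc_coeff (nc_eps (f * g)) w = nc_coeff (nc_eps g * nc_eps f) w" .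
qed

text \<open>Differentiation and integration in a parameter are coefficientwise.\<close>

definition nc_deriv :: "(complex \<Rightarrow> complex ncps) \<Rightarrow> complex \<Rightarrow> complex ncps" where
  "nc_deriv F T = Abs_ncps (\<lambda>w. deriv (\<lambda>u. nc_coeff (F u) w) T)"

definition nc_contour_integral :: "(real \<Rightarrow> complex) \<Rightarrow> (complex \<Rightarrow> complex ncps) \<Rightarrow> complex ncps" where
  "nc_contour_integral p F = Abs_ncps (\<lambda>w. contour_integral p (\<lambda>u. nc_coeff (F u) w))"


section \<open>The generating series\<close>

definition Gamma1 :: "complex fps" where
  "Gamma1 = fps_exp 1 oo
     Abs_fps (\<lambda>k. if 2 \<le> k then (\<Sum>n. 1 / of_nat (Suc n) ^ k) / of_nat k * (-1) ^ k else 0)"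

definition Phi_sh :: "complex \<Rightarrow> complex ncps" where
  "Phi_sh T = Abs_ncps (\<lambda>w. reg_integral dch (map of_bool w)) * fps_at_var (fps_exp (- T)) True"

text \<open>Substituting \<open>X\<^sub>1\<close> in a series is a ring homomorphism, so the inverse is taken before.\<close>

definition Phi_st :: "complex \<Rightarrow> complex ncps" where
  "Phi_st T = Phi_sh T * fps_at_var (inverse (Gamma1 oo - fps_X)) True"

definition Phi_sh_S :: "complex \<Rightarrow> complex \<Rightarrow> complex ncps" where
  "Phi_sh_S T1 T2 = Phi_sh T1 * nc_var True * nc_eps (Phi_sh T2)"

definition Phi_st_S :: "complex \<Rightarrow> complex \<Rightarrow> complex ncps" where
  "Phi_st_S T1 T2 = Phi_st T1 * nc_var True * nc_eps (Phi_st T2)"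

definition Z_RS :: "bool list \<Rightarrow> complex" where
  "Z_RS w = 1 / (2 * of_real pi * \<i>) * reg_integral loop_beta (map of_bool w)"

definition Phi_RS :: "complex ncps" where
  "Phi_RS = Abs_ncps (\<lambda>w. if w = [] then 0 else Z_RS w)"

definition L_n :: "int \<Rightarrow> bool list \<Rightarrow> complex" where
  "L_n n w = reg_integral (loop_beta_n n) (map of_bool w)"

definition L_poly :: "bool list \<Rightarrow> complex poly" where
  "L_poly w = (THE p. \<forall>n. L_n n w = poly p (2 * of_real pi * \<i> * of_int n))"

definition Phi_L :: "complex \<Rightarrow> complex ncps" where
  "Phi_L T = Abs_ncps (\<lambda>w. poly (L_poly w) T)"

end

theory Submission
  imports Defs "HOL-Real_Asymp.Real_Asymp"
begin

text \<open>Along a path \<open>g\<close> the generating series \<open>\<Sum>I(w; s, u) X\<^sub>w\<close> of iterated integrals solves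
  \<open>dF = - (X\<^sub>0 dz / z + X\<^sub>1 dz / (z - 1)) F\<close> in \<open>s\<close>.  Since \<open>\<epsilon>\<close> negates the connection form,
  \<open>\<epsilon>(F) G\<close> is constant for any two solutions; hence solutions are invertible with inverse \<open>\<epsilon>(F)\<close>
  and are determined by one value.  Near a puncture, in a coordinate \<open>s\<close>, there is a solution
  \<open>P(s) exp(- log s X\<^sub>c)\<close> with \<open>P\<close> holomorphic and \<open>P(0) = 1\<close>, and the regularized series of a path
  is the matrix connecting these solutions at its two ends.  It is multiplicative in the path, and
  continuing \<open>log s\<close> once around 1 gives \<open>exp(2\<pi>i X\<^sub>1)\<close> for \<open>\<alpha>\<close>, with no homotopy argument.  So
  \<open>\<Phi>\<^sup>L(T) = \<Phi> exp(T X\<^sub>1) \<epsilon>(\<Phi>)\<close> with \<open>\<Phi>\<close> the series of \<open>dch\<close>, and all identities are algebra, apart from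
  \<open>X / (\<Gamma>\<^sub>1(X) \<Gamma>\<^sub>1(-X)) = sin(\<pi>X) / \<pi>\<close>, which is the reflection formula because
  \<open>\<Gamma>\<^sub>1(t) = exp(\<gamma>t) \<Gamma>(1 + t)\<close> with \<open>\<gamma>\<close> the Euler constant.\<close>

section \<open>Noncommutative power series\<close>

lemma nc_coeff_simps [simp]:
  "nc_coeff 0 w = 0"
  "nc_coeff 1 w = (if w = [] then 1 else 0)"
  "nc_coeff (f + g) w = nc_coeff f w + nc_coeff g w"
  "nc_coeff (f - g) w = nc_coeff f w - nc_coeff g w"
  "nc_coeff (- f) w = - nc_coeff f w"
  "nc_coeff (nc_scale c f) w = c * nc_coeff f w"
  "nc_coeff (nc_var a) w = (if w = [a] then 1 else 0)"
  "nc_coeff (nc_eps f) w = (-1) ^ length w * nc_coeff f (rev w)"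
  "nc_coeff (fps_at_var p a) w = (if set w \<subseteq> {a} then fps_nth p (length w) else 0)"
  by (simp_all add: zero_ncps_def one_ncps_def plus_ncps_def minus_ncps_def uminus_ncps_def
      nc_scale_def nc_var_def nc_eps_def fps_at_var_def)

lemma nc_coeff_mult:
  "nc_coeff (f * g) w = (\<Sum>k\<le>length w. nc_coeff f (take k w) * nc_coeff g (drop k w))"
  by (simp add: times_ncps_def atLeast0AtMost)

lemma nc_coeff_mult_Nil [simp]: "nc_coeff (f * g) [] = nc_coeff f [] * nc_coeff g []"
  by (simp add: nc_coeff_mult)

lemma nc_scale_mult_left: "nc_scale c f * g = nc_scale c (f * g)"
  by (rule ncps_eqI) (simp add: nc_coeff_mult sum_distrib_left mult.assoc)

lemma nc_scale_mult_right:
  fixes f :: "'a::comm_ring_1 ncps"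
  shows "f * nc_scale c g = nc_scale c (f * g)"
  by (rule ncps_eqI) (simp add: nc_coeff_mult sum_distrib_left mult_ac)

lemma nc_coeff_var_mult:
  "nc_coeff (nc_var a * f) w = (if w \<noteq> [] \<and> hd w = a then nc_coeff f (tl w) else 0)"
proof (cases w)
  case (Cons b v)
  have "nc_coeff (nc_var a * f) w = (\<Sum>k\<in>{1}. nc_coeff (nc_var a) (take k w) * nc_coeff f (drop k w))"
    unfolding nc_coeff_mult
    by (rule sum.mono_neutral_right) (auto simp: Cons take_Cons' split: if_splits)
  then show ?thesis by (auto simp: Cons)
qed simp

lemma nc_eps_eps [simp]:
  fixes f :: "'a::comm_ring_1 ncps"
  shows "nc_eps (nc_eps f) = f"
  by (rule ncps_eqI) (simp flip: mult.assoc power_mult_distrib)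

lemma nc_eps_scale:
  fixes f :: "'a::comm_ring_1 ncps"
  shows "nc_eps (nc_scale c f) = nc_scale c (nc_eps f)"
  by (rule ncps_eqI) (simp add: mult_ac)

lemma nc_eps_minus: "nc_eps (- f) = - nc_eps f"
  by (rule ncps_eqI) simp

text \<open>Since \<open>nc_eps\<close> reverses products, this is \<open>nc_coeff_var_mult\<close>
  read from the other end of the word.\<close>

lemma nc_coeff_mult_var:
  fixes f :: "'a::comm_ring_1 ncps"
  shows "nc_coeff (f * nc_var a) w = (if w \<noteq> [] \<and> last w = a then nc_coeff f (butlast w) else 0)"
proof -
  have "f * nc_var a = - nc_eps (nc_var a * nc_eps f)"
    by (simp add: nc_eps_mult nc_eps_var)
  moreover have "(-1) ^ length w * ((-1) ^ (length w - Suc 0) * c) = - c" if "w \<noteq> []" for c :: 'a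
    using that by (cases w) (simp_all flip: mult.assoc power_mult_distrib)
  ultimately show ?thesis
    by (auto simp: nc_coeff_var_mult hd_rev simp del: rev.simps simp flip: butlast_rev)
qed

text \<open>In the coefficient of \<open>e * e\<close> at \<open>w\<close> the two trivial
  splittings vanish because the constant coefficient is 0; the others involve only shorter words,
  where induction applies.\<close>

lemma nc_idempotent_eq_0:
  assumes "e * e = e" "nc_coeff e [] = 0"
  shows "e = 0"
proof (rule ncps_eqI)
  fix w
  show "nc_coeff e w = nc_coeff 0 w"
  proof (induction w rule: length_induct)
    case (1 w)
    have "nc_coeff e (take k w) * nc_coeff e (drop k w) = 0" if "k \<le> length w" for k
    proof (cases "k = 0 \<or> k = length w")
      case False
      with that have "length (take k w) < length w" by simp
      with 1 show ?thesis by simp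
    qed (use assms(2) in auto)
    then have "nc_coeff (e * e) w = 0" by (simp add: nc_coeff_mult)
    then show ?case by (simp add: assms(1))
  qed
qed

text \<open>From \<open>f * g = 1\<close> it follows that \<open>1 - g * f\<close> is idempotent,
  and its constant coefficient is 0.\<close>

lemma nc_left_inverse_imp_right_inverse:
  assumes "f * g = 1" "nc_coeff g [] = (1::'a::ring_1)"
  shows "g * f = 1"
proof -
  have "nc_coeff (f * g) [] = 1" by (simp only: assms) simp
  then have f0: "nc_coeff f [] = 1" by (simp only: nc_coeff_mult_Nil assms(2) mult_1_right)
  have "(1 - g * f) * (1 - g * f) = 1 - g * f - g * f + g * (f * g) * f"
    by (simp add: algebra_simps)
  then have "(1 - g * f) * (1 - g * f) = 1 - g * f"
    by (simp add: assms(1))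
  then have "1 - g * f = 0"
    by (rule nc_idempotent_eq_0) (simp add: f0 assms(2))
  then show ?thesis by simp
qed

section \<open>Series in a single letter and the exponential\<close>

lemma fps_at_var_mult:
  "fps_at_var (f * g) a = fps_at_var f a * fps_at_var g a"
proof (rule ncps_eqI)
  fix w
  have "set (take k w) \<subseteq> {a} \<and> set (drop k w) \<subseteq> {a} \<longleftrightarrow> set w \<subseteq> {a}" for k
    by (metis append_take_drop_id set_append Un_subset_iff)
  then have "(\<Sum>k\<le>length w. nc_coeff (fps_at_var f a) (take k w) * nc_coeff (fps_at_var g a) (drop k w))
    = (\<Sum>k\<le>length w. if set w \<subseteq> {a} then fps_nth f k * fps_nth g (length w - k) else 0)"
    by (intro sum.cong) (auto simp: min_def)
  then show "nc_coeff (fps_at_var (f * g) a) w = nc_coeff (fps_at_var f a * fps_at_var g a) w"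
    by (simp add: nc_coeff_mult fps_mult_nth atLeast0AtMost)
qed

lemma fps_at_var_1 [simp]: "fps_at_var 1 a = 1"
  by (rule ncps_eqI) auto

lemma fps_at_var_X: "fps_at_var fps_X a = nc_var a"
proof (rule ncps_eqI)
  fix w show "nc_coeff (fps_at_var fps_X a) w = nc_coeff (nc_var a) w"
    by (cases w) auto
qed

lemma fps_at_var_diff: "fps_at_var (f - g) a = fps_at_var f a - fps_at_var g a"
  by (rule ncps_eqI) auto

lemma fps_at_var_const_mult: "fps_at_var (fps_const c * f) a = nc_scale c (fps_at_var f a)"
  by (rule ncps_eqI) auto

text \<open>Words in one letter are palindromes, so only the sign of \<open>nc_eps\<close> is
  felt.\<close>

lemma nc_eps_fps_at_var:
  fixes f :: "'a::comm_ring_1 fps"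
  shows "nc_eps (fps_at_var f a) = fps_at_var (f oo - fps_X) a"
  by (rule ncps_eqI) (auto simp: fps_compose_uminus')

definition nc_exp :: "complex \<Rightarrow> bool \<Rightarrow> complex ncps" where
  "nc_exp T a = fps_at_var (fps_exp T) a"

lemma nc_exp_add: "nc_exp (S + T) a = nc_exp S a * nc_exp T a"
  by (simp add: nc_exp_def fps_exp_add_mult fps_at_var_mult)

lemma nc_exp_0 [simp]: "nc_exp 0 a = 1"
  by (simp add: nc_exp_def)

lemma nc_coeff_exp: "nc_coeff (nc_exp T a) w = (if set w \<subseteq> {a} then T ^ length w / fact (length w) else 0)"
  by (simp add: nc_exp_def)

lemma nc_eps_exp: "nc_eps (nc_exp T a) = nc_exp (- T) a"
  by (rule ncps_eqI) (simp add: nc_coeff_exp power_minus[of T])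

lemma nc_var_exp: "nc_var a * nc_exp T a = nc_exp T a * nc_var a"
  by (simp add: nc_exp_def mult.commute flip: fps_at_var_X fps_at_var_mult)

section \<open>Coefficientwise derivatives\<close>

definition nc_has_deriv :: "(real \<Rightarrow> complex ncps) \<Rightarrow> complex ncps \<Rightarrow> real \<Rightarrow> bool" where
  "nc_has_deriv F D t \<longleftrightarrow>
     (\<forall>w. ((\<lambda>s. nc_coeff (F s) w) has_vector_derivative nc_coeff D w) (at t))"

lemma nc_has_deriv_const: "nc_has_deriv (\<lambda>_. K) 0 t"
  by (simp add: nc_has_deriv_def)

lemma nc_has_deriv_eps: "nc_has_deriv F D t \<Longrightarrow> nc_has_deriv (\<lambda>s. nc_eps (F s)) (nc_eps D) t"
  by (auto simp: nc_has_deriv_def intro!: has_vector_derivative_mult_right)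

lemma nc_has_deriv_mult:
  assumes F: "nc_has_deriv F D t" and G: "nc_has_deriv G E t"
  shows "nc_has_deriv (\<lambda>s. F s * G s) (D * G t + F t * E) t"
  unfolding nc_has_deriv_def
proof
  fix w
  have "((\<lambda>s. \<Sum>k\<le>length w. nc_coeff (F s) (take k w) * nc_coeff (G s) (drop k w)) has_vector_derivative
     (\<Sum>k\<le>length w. nc_coeff (F t) (take k w) * nc_coeff E (drop k w)
        + nc_coeff D (take k w) * nc_coeff (G t) (drop k w))) (at t)"
    using F G unfolding nc_has_deriv_def
    by (intro has_vector_derivative_sum has_vector_derivative_mult) auto
  then show "((\<lambda>s. nc_coeff (F s * G s) w) has_vector_derivative nc_coeff (D * G t + F t * E) w) (at t)"
    by (simp add: nc_coeff_mult sum.distrib add.commute)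
qed

lemma nc_has_deriv_cong:
  assumes "nc_has_deriv F D t" "open S" "t \<in> S" "\<And>s. s \<in> S \<Longrightarrow> F s = G s"
  shows "nc_has_deriv G D t"
  unfolding nc_has_deriv_def
proof
  fix w
  show "((\<lambda>s. nc_coeff (G s) w) has_vector_derivative nc_coeff D w) (at t)"
  proof (rule has_vector_derivative_transform_within_open[OF _ assms(2,3)])
    show "((\<lambda>s. nc_coeff (F s) w) has_vector_derivative nc_coeff D w) (at t)"
      using assms(1) by (simp add: nc_has_deriv_def)
  qed (simp add: assms(4))
qed

lemma nc_has_deriv_exp:
  assumes "(l has_vector_derivative d) (at t)"
  shows "nc_has_deriv (\<lambda>s. nc_exp (l s) a) (nc_scale d (nc_var a * nc_exp (l t) a)) t"
  unfolding nc_has_deriv_def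
proof
  fix w :: "bool list"
  have *: "((\<lambda>s. l s ^ Suc n / fact (Suc n)) has_vector_derivative d * (l t ^ n / fact n)) (at t)" for n
  proof -
    have "((\<lambda>z. z ^ Suc n / fact (Suc n)) has_field_derivative (l t ^ n / fact n)) (at (l t))"
      by (rule DERIV_cong[OF DERIV_cdivide[OF DERIV_power[OF DERIV_ident, of "Suc n"]]])
        (simp del: of_nat_Suc)
    from field_vector_diff_chain_at[OF assms this] show ?thesis by (simp only: o_def)
  qed
  show "((\<lambda>s. nc_coeff (nc_exp (l s) a) w) has_vector_derivative
         nc_coeff (nc_scale d (nc_var a * nc_exp (l t) a)) w) (at t)"
  proof (cases w)
    case (Cons b v)
    show ?thesis
      using *[of "length v"] by (auto simp: Cons nc_coeff_exp nc_coeff_var_mult)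
  qed (simp add: nc_coeff_exp)
qed

section \<open>Coefficientwise continuity and constancy\<close>

definition nc_continuous_on :: "real set \<Rightarrow> (real \<Rightarrow> complex ncps) \<Rightarrow> bool" where
  "nc_continuous_on S F \<longleftrightarrow> (\<forall>w. continuous_on S (\<lambda>s. nc_coeff (F s) w))"

lemma nc_continuous_on_const: "nc_continuous_on S (\<lambda>_. K)"
  by (simp add: nc_continuous_on_def)

lemma nc_continuous_on_subset: "nc_continuous_on S F \<Longrightarrow> T \<subseteq> S \<Longrightarrow> nc_continuous_on T F"
  by (auto simp: nc_continuous_on_def intro: continuous_on_subset)

lemma nc_continuous_on_mult:
  "nc_continuous_on S F \<Longrightarrow> nc_continuous_on S G \<Longrightarrow> nc_continuous_on S (\<lambda>s. F s * G s)"
  by (auto simp: nc_continuous_on_def nc_coeff_mult intro!: continuous_intros)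

lemma nc_continuous_on_eps:
  "nc_continuous_on S F \<Longrightarrow> nc_continuous_on S (\<lambda>s. nc_eps (F s))"
  by (auto simp: nc_continuous_on_def intro!: continuous_intros)

lemma nc_continuous_on_compose:
  "nc_continuous_on T F \<Longrightarrow> continuous_on S r \<Longrightarrow> r ` S \<subseteq> T \<Longrightarrow> nc_continuous_on S (\<lambda>s. F (r s))"
  by (auto simp: nc_continuous_on_def intro: continuous_on_compose2)

lemma nc_continuous_on_cong:
  "nc_continuous_on S F \<Longrightarrow> (\<And>s. s \<in> S \<Longrightarrow> F s = G s) \<Longrightarrow> nc_continuous_on S G"
  unfolding nc_continuous_on_def by (metis (no_types, lifting) continuous_on_cong)

lemma nc_continuous_on_cases:
  assumes "nc_continuous_on {a..b} F" "nc_continuous_on {b..c} G" "F b = G b" "a \<le> b" "b \<le> c"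
  shows "nc_continuous_on {a..c} (\<lambda>s. if s \<le> b then F s else G s)"
  unfolding nc_continuous_on_def
proof
  fix w
  have "{s \<in> {a..c}. s \<le> b} = {a..b}" "{s \<in> {a..c}. b \<le> s} = {b..c}"
    using assms(4,5) by auto
  then have "continuous_on {a..c} (\<lambda>s. if s \<le> b then nc_coeff (F s) w else nc_coeff (G s) w)"
    using assms(1-3) by (intro continuous_on_cases_le) (auto simp: nc_continuous_on_def)
  then show "continuous_on {a..c} (\<lambda>s. nc_coeff (if s \<le> b then F s else G s) w)"
    by (simp add: if_distrib[of "\<lambda>f. nc_coeff f w"])
qed

text \<open>Paths are only piecewise differentiable: the derivative may be missing on a finite set,
  and continuity carries the constant across it.\<close>

lemma nc_constant:
  assumes "finite S" "nc_continuous_on {a..b} F"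
    "\<And>t. t \<in> {a<..<b} - S \<Longrightarrow> nc_has_deriv F 0 t" "s \<in> {a..b}"
  shows "F s = F a"
proof (rule ncps_eqI)
  fix w
  show "nc_coeff (F s) w = nc_coeff (F a) w"
  proof (rule has_derivative_zero_unique_strong_interval[where k = "S \<union> {a, b}"])
    fix x assume "x \<in> {a..b} - (S \<union> {a, b})"
    with assms(3)[of x] have "((\<lambda>s. nc_coeff (F s) w) has_vector_derivative 0) (at x)"
      by (auto simp: nc_has_deriv_def)
    then show "((\<lambda>s. nc_coeff (F s) w) has_derivative (\<lambda>h. 0)) (at x within {a..b})"
      by (simp add: has_vector_derivative_def has_derivative_at_withinI)
  qed (use assms in \<open>auto simp: nc_continuous_on_def\<close>)
qed

section \<open>Horizontal sections\<close>

text \<open>The coefficient of dz in the formal Knizhnik-Zamolodchikov connection form.\<close>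

definition nc_conn :: "complex \<Rightarrow> complex ncps" where
  "nc_conn z = nc_scale (1 / z) (nc_var False) + nc_scale (1 / (z - 1)) (nc_var True)"

lemma nc_scale_uminus: "nc_scale c (- f) = - nc_scale c f"
  by (rule ncps_eqI) simp

lemma nc_eps_conn: "nc_eps (nc_conn z) = - nc_conn z"
  by (simp add: nc_conn_def nc_eps_add nc_eps_scale nc_eps_var nc_scale_uminus)

text \<open>Exhibiting a solution \<open>F\<close> makes the fundamental theorem of calculus produce the iterated
  integrals, so that no integrability of \<open>g'\<close> has to be assumed.\<close>

definition horizontal :: "(real \<Rightarrow> complex) \<Rightarrow> (real \<Rightarrow> complex ncps) \<Rightarrow> real \<Rightarrow> real \<Rightarrow> bool" where
  "horizontal g F a b \<longleftrightarrow> nc_continuous_on {a..b} F \<and>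
     (\<exists>S. finite S \<and> (\<forall>t\<in>{a<..<b} - S. \<exists>D. (g has_vector_derivative D) (at t) \<and>
        nc_has_deriv F (- nc_scale D (nc_conn (g t) * F t)) t))"

lemma horizontalD: "horizontal g F a b \<Longrightarrow> nc_continuous_on {a..b} F"
  by (simp add: horizontal_def)

lemma horizontal_subinterval:
  assumes "horizontal g F a b" "a \<le> a'" "b' \<le> b"
  shows "horizontal g F a' b'"
proof -
  have "{a'..b'} \<subseteq> {a..b}" using assms by auto
  with assms show ?thesis
    unfolding horizontal_def
    by (meson Diff_iff greaterThanLessThan_iff nc_continuous_on_subset order_le_less_trans order_less_le_trans)
qed

lemma horizontal_cong:
  assumes h: "horizontal g F a b"
    and eq: "\<And>t. t \<in> {a..b} \<Longrightarrow> g' t = g t" "\<And>t. t \<in> {a..b} \<Longrightarrow> F' t = F t"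
  shows "horizontal g' F' a b"
proof -
  obtain S where S: "finite S"
      "\<And>t. t \<in> {a<..<b} - S \<Longrightarrow> \<exists>D. (g has_vector_derivative D) (at t) \<and>
        nc_has_deriv F (- nc_scale D (nc_conn (g t) * F t)) t"
    using h by (auto simp: horizontal_def)
  have "\<exists>D. (g' has_vector_derivative D) (at t) \<and>
        nc_has_deriv F' (- nc_scale D (nc_conn (g' t) * F' t)) t" if t: "t \<in> {a<..<b} - S" for t
  proof -
    obtain D where D: "(g has_vector_derivative D) (at t)"
        "nc_has_deriv F (- nc_scale D (nc_conn (g t) * F t)) t"
      using S(2)[OF t] by blast
    have "(g' has_vector_derivative D) (at t)"
      by (rule has_vector_derivative_transform_within_open[OF D(1), of "{a<..<b}"]) (use t eq in auto)
    moreover have "nc_has_deriv F' (- nc_scale D (nc_conn (g t) * F t)) t"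
      by (rule nc_has_deriv_cong[OF D(2), of "{a<..<b}"]) (use t eq in auto)
    ultimately show ?thesis using t eq by auto
  qed
  moreover have "nc_continuous_on {a..b} F'"
    by (rule nc_continuous_on_cong[OF horizontalD[OF h]]) (simp add: eq)
  ultimately show ?thesis using S(1) unfolding horizontal_def by blast
qed

lemma horizontal_mult_right:
  assumes "horizontal g F a b"
  shows "horizontal g (\<lambda>t. F t * K) a b"
proof -
  have "nc_has_deriv (\<lambda>t. F t * K) (- nc_scale D (nc_conn (g t) * (F t * K))) t"
    if "nc_has_deriv F (- nc_scale D (nc_conn (g t) * F t)) t" for D t
    using nc_has_deriv_mult[OF that nc_has_deriv_const[of K]]
    by (simp add: nc_scale_mult_left mult.assoc)
  moreover have "nc_continuous_on {a..b} (\<lambda>t. F t * K)"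
    by (intro nc_continuous_on_mult horizontalD[OF assms] nc_continuous_on_const)
  ultimately show ?thesis
    using assms unfolding horizontal_def by meson
qed

lemma horizontal_append:
  assumes 1: "horizontal g F a b" and 2: "horizontal g G b c"
    and eq: "F b = G b" and ord: "a \<le> b" "b \<le> c"
  shows "horizontal g (\<lambda>t. if t \<le> b then F t else G t) a c" (is "horizontal g ?H a c")
proof -
  have *: "\<exists>S. finite S \<and> (\<forall>t\<in>{u<..<v} - S. \<exists>D. (g has_vector_derivative D) (at t) \<and>
        nc_has_deriv ?H (- nc_scale D (nc_conn (g t) * ?H t)) t)"
    if "horizontal g ?H u v" for u v
    using that by (simp add: horizontal_def)
  have "horizontal g ?H a b"
    by (rule horizontal_cong[OF 1]) auto
  from *[OF this] obtain S1 where S1: "finite S1"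
      "\<And>t. t\<in>{a<..<b} - S1 \<Longrightarrow> \<exists>D. (g has_vector_derivative D) (at t) \<and>
        nc_has_deriv ?H (- nc_scale D (nc_conn (g t) * ?H t)) t" by blast
  have "horizontal g ?H b c"
    by (rule horizontal_cong[OF 2]) (auto simp: eq)
  from *[OF this] obtain S2 where S2: "finite S2"
      "\<And>t. t\<in>{b<..<c} - S2 \<Longrightarrow> \<exists>D. (g has_vector_derivative D) (at t) \<and>
        nc_has_deriv ?H (- nc_scale D (nc_conn (g t) * ?H t)) t" by blast
  \<comment> \<open>The gluing time joins the exceptional set, since the one-sided derivatives may
    differ there.\<close>
  have "\<exists>D. (g has_vector_derivative D) (at t) \<and>
        nc_has_deriv ?H (- nc_scale D (nc_conn (g t) * ?H t)) t"
    if t: "t\<in>{a<..<c} - insert b (S1 \<union> S2)" for t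
  proof (cases "t < b")
    case True
    then show ?thesis by (intro S1(2)) (use t in auto)
  next
    case False
    then show ?thesis by (intro S2(2)) (use t in auto)
  qed
  moreover have "nc_continuous_on {a..c} ?H"
    using nc_continuous_on_cases[OF horizontalD[OF 1] horizontalD[OF 2]] eq ord by blast
  moreover have "finite (insert b (S1 \<union> S2))" using S1 S2 by simp
  ultimately show ?thesis unfolding horizontal_def by blast
qed

text \<open>A negative \<open>m\<close> is allowed and covers reversed time. The chain rule puts the
  factor \<open>m\<close> into the velocity of the path and into the derivative of the section
  alike.\<close>

lemma horizontal_affine:
  assumes h: "horizontal g F a b" and m: "m \<noteq> 0"
    and cl: "\<And>t. t \<in> {a'..b'} \<Longrightarrow> m * t + d \<in> {a..b}"
    and op: "\<And>t. t \<in> {a'<..<b'} \<Longrightarrow> m * t + d \<in> {a<..<b}"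
  shows "horizontal (\<lambda>t. g (m * t + d)) (\<lambda>t. F (m * t + d)) a' b'"
proof -
  obtain S where S: "finite S"
      "\<And>t. t \<in> {a<..<b} - S \<Longrightarrow> \<exists>D. (g has_vector_derivative D) (at t) \<and>
        nc_has_deriv F (- nc_scale D (nc_conn (g t) * F t)) t"
    using h by (auto simp: horizontal_def)
  define S' where "S' = (\<lambda>s. (s - d) / m) ` S"
  have "\<exists>D. ((\<lambda>t. g (m * t + d)) has_vector_derivative D) (at t) \<and>
        nc_has_deriv (\<lambda>t. F (m * t + d)) (- nc_scale D (nc_conn (g (m * t + d)) * F (m * t + d))) t"
    if t: "t \<in> {a'<..<b'} - S'" for t
  proof -
    have "m * t + d \<notin> S"
    proof
      assume "m * t + d \<in> S"
      moreover have "t = ((m * t + d) - d) / m" using m by simp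
      ultimately show False using t unfolding S'_def by blast
    qed
    with op[of t] t S(2)[of "m * t + d"] obtain D where D: "(g has_vector_derivative D) (at (m * t + d))"
        "nc_has_deriv F (- nc_scale D (nc_conn (g (m * t + d)) * F (m * t + d))) (m * t + d)"
      by blast
    have aff: "((\<lambda>t. m * t + d) has_vector_derivative m) (at t)"
      by (auto intro!: derivative_eq_intros simp flip: has_real_derivative_iff_has_vector_derivative)
    have comp: "((\<lambda>t. f (m * t + d)) has_vector_derivative of_real m * E) (at t)"
      if "(f has_vector_derivative E) (at (m * t + d))" for f :: "real \<Rightarrow> complex" and E
      using vector_diff_chain_at[OF aff that] by (simp add: o_def scaleR_conv_of_real)
    have "nc_has_deriv (\<lambda>t. F (m * t + d))
        (- nc_scale (of_real m * D) (nc_conn (g (m * t + d)) * F (m * t + d))) t"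
      unfolding nc_has_deriv_def
    proof
      fix w
      have "((\<lambda>t. nc_coeff (F t) w) has_vector_derivative
          nc_coeff (- nc_scale D (nc_conn (g (m * t + d)) * F (m * t + d))) w) (at (m * t + d))"
        using D(2) unfolding nc_has_deriv_def by blast
      from comp[OF this]
      show "((\<lambda>t. nc_coeff (F (m * t + d)) w) has_vector_derivative
          nc_coeff (- nc_scale (of_real m * D) (nc_conn (g (m * t + d)) * F (m * t + d))) w) (at t)"
        by (simp add: mult_ac)
    qed
    with comp[OF D(1)] show ?thesis by blast
  qed
  moreover have "nc_continuous_on {a'..b'} (\<lambda>t. F (m * t + d))"
    by (rule nc_continuous_on_compose[OF horizontalD[OF h]]) (use cl in \<open>auto intro!: continuous_intros\<close>)
  moreover have "finite S'" using S(1) by (simp add: S'_def)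
  ultimately show ?thesis unfolding horizontal_def by blast
qed

lemma horizontal_pairing_const:
  assumes F: "horizontal g F a b" and G: "horizontal g G a b" and st: "s \<in> {a..b}" "t \<in> {a..b}"
  shows "nc_eps (F s) * G s = nc_eps (F t) * G t"
proof -
  obtain S where S: "finite S"
      "\<And>t. t \<in> {a<..<b} - S \<Longrightarrow> \<exists>D. (g has_vector_derivative D) (at t) \<and>
        nc_has_deriv F (- nc_scale D (nc_conn (g t) * F t)) t"
    using F by (auto simp: horizontal_def)
  obtain S' where S': "finite S'" "\<And>t. t \<in> {a<..<b} - S' \<Longrightarrow> \<exists>D. (g has_vector_derivative D) (at t) \<and>
        nc_has_deriv G (- nc_scale D (nc_conn (g t) * G t)) t"
    using G by (auto simp: horizontal_def)
  have fin: "finite (S \<union> S')" using S S' by simp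
  have cont: "nc_continuous_on {a..b} (\<lambda>t. nc_eps (F t) * G t)"
    by (intro nc_continuous_on_mult nc_continuous_on_eps horizontalD[OF F] horizontalD[OF G])
  have der: "nc_has_deriv (\<lambda>t. nc_eps (F t) * G t) 0 t" if t: "t \<in> {a<..<b} - (S \<union> S')" for t
  proof -
    obtain D where D: "(g has_vector_derivative D) (at t)"
        "nc_has_deriv F (- nc_scale D (nc_conn (g t) * F t)) t"
      using S(2)[of t] t by blast
    obtain D' where D': "(g has_vector_derivative D') (at t)"
        "nc_has_deriv G (- nc_scale D' (nc_conn (g t) * G t)) t"
      using S'(2)[of t] t by blast
    \<comment> \<open>Each section comes with its own velocity, so uniqueness of derivatives
      identifies them first; then the two terms of the product rule cancel by
      \<open>nc_eps_conn\<close>.\<close>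
    have "D' = D" using D(1) D'(1) by (rule vector_derivative_unique_at[symmetric])
    with nc_has_deriv_mult[OF nc_has_deriv_eps[OF D(2)] D'(2)] show ?thesis
      by (simp add: nc_eps_minus nc_eps_scale nc_eps_mult nc_eps_conn nc_scale_uminus
          nc_scale_mult_left nc_scale_mult_right mult.assoc)
  qed
  show ?thesis
    using nc_constant[OF fin cont der st(1)] nc_constant[OF fin cont der st(2)] by simp
qed

text \<open>The first letter belongs to the outermost integration, and left multiplication by the
  connection strips exactly the first letter. The fundamental theorem of calculus then gives the
  integral; \<open>F u = 1\<close> removes the boundary term at \<open>u\<close>.\<close>

lemma iterated_integral_horizontal:
  assumes h: "horizontal g F s u" and su: "s \<le> u" and u: "F u = 1"
  shows "iterated_integral g (map of_bool w) s u = nc_coeff (F s) w"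
  using h su
proof (induction w arbitrary: s)
  case Nil
  obtain S where S: "finite S"
      "\<And>t. t \<in> {s<..<u} - S \<Longrightarrow> \<exists>D. (g has_vector_derivative D) (at t) \<and>
        nc_has_deriv F (- nc_scale D (nc_conn (g t) * F t)) t"
    using Nil(1) by (auto simp: horizontal_def)
  \<comment> \<open>The connection has no constant term, so the constant coefficient has derivative
    0 off a finite set.\<close>
  have "((\<lambda>_. 0) has_integral nc_coeff (F u) [] - nc_coeff (F s) []) {s..u}"
  proof (rule fundamental_theorem_of_calculus_interior_strong[OF S(1) Nil(2)])
    fix t assume "t \<in> {s<..<u} - S"
    from S(2)[OF this] obtain D where "nc_has_deriv F (- nc_scale D (nc_conn (g t) * F t)) t" by blast
    then have "((\<lambda>t. nc_coeff (F t) []) has_vector_derivative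
        nc_coeff (- nc_scale D (nc_conn (g t) * F t)) []) (at t)"
      by (simp only: nc_has_deriv_def)
    then show "((\<lambda>t. nc_coeff (F t) []) has_vector_derivative 0) (at t)"
      by (simp add: nc_conn_def)
  qed (use horizontalD[OF Nil(1)] in \<open>simp add: nc_continuous_on_def\<close>)
  then have "nc_coeff (F u) [] - nc_coeff (F s) [] = 0"
    by (rule has_integral_unique) simp
  then show ?case by (simp add: u)
next
  case (Cons b w)
  obtain S where S: "finite S"
      "\<And>t. t \<in> {s<..<u} - S \<Longrightarrow> \<exists>D. (g has_vector_derivative D) (at t) \<and>
        nc_has_deriv F (- nc_scale D (nc_conn (g t) * F t)) t"
    using Cons.prems(1) by (auto simp: horizontal_def)
  let ?f = "\<lambda>t. vector_derivative g (at t) / (g t - of_bool b) * iterated_integral g (map of_bool w) t u"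
  have "((\<lambda>t. - ?f t) has_integral nc_coeff (F u) (b # w) - nc_coeff (F s) (b # w)) {s..u}"
  proof (rule fundamental_theorem_of_calculus_interior_strong[OF S(1) Cons.prems(2)])
    fix t assume t: "t \<in> {s<..<u} - S"
    from S(2)[OF this] obtain D where D: "(g has_vector_derivative D) (at t)"
      "nc_has_deriv F (- nc_scale D (nc_conn (g t) * F t)) t" by blast
    have "((\<lambda>t. nc_coeff (F t) (b # w)) has_vector_derivative
        nc_coeff (- nc_scale D (nc_conn (g t) * F t)) (b # w)) (at t)"
      using D(2) by (simp only: nc_has_deriv_def)
    moreover have "iterated_integral g (map of_bool w) t u = nc_coeff (F t) w"
      using t by (intro Cons.IH horizontal_subinterval[OF Cons.prems(1)]) auto
    moreover have "nc_coeff (nc_conn (g t) * F t) (b # w) = nc_coeff (F t) w / (g t - of_bool b)"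
      by (auto simp: nc_conn_def distrib_right nc_scale_mult_left nc_coeff_var_mult)
    ultimately show "((\<lambda>t. nc_coeff (F t) (b # w)) has_vector_derivative - ?f t) (at t)"
      using vector_derivative_at[OF D(1)] by simp
  qed (use horizontalD[OF Cons.prems(1)] in \<open>simp add: nc_continuous_on_def\<close>)
  then have "(?f has_integral nc_coeff (F s) (b # w)) {s..u}"
    by (drule_tac has_integral_neg) (simp add: u)
  then show ?case by (simp add: integral_unique)
qed

section \<open>Expansions in powers of the logarithm\<close>

lemma bigo_tendsto_0:
  assumes "f \<in> O[F](g)" "(g \<longlongrightarrow> 0) F"
  shows "(f \<longlongrightarrow> (0::complex)) F"
proof -
  obtain c where "eventually (\<lambda>x. norm (f x) \<le> c * norm (g x)) F"
    using assms(1) by (elim landau_o.bigE)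
  moreover have "((\<lambda>x. c * norm (g x)) \<longlongrightarrow> 0) F"
    using tendsto_mult_left[OF tendsto_norm_zero[OF assms(2)], of c] by simp
  ultimately show ?thesis by (rule Lim_null_comparison)
qed

text \<open>A polynomial in log t in place of a coefficient sequence turns products of expansions
  into products of polynomials; its degree controls the power of the logarithm in the error of a
  product.\<close>

definition has_log_const :: "nat \<Rightarrow> (real \<Rightarrow> complex) \<Rightarrow> complex \<Rightarrow> bool" where
  "has_log_const n f a \<longleftrightarrow> (\<exists>p. degree p \<le> n \<and> poly p 0 = a \<and>
     (\<lambda>t. f t - poly p (of_real (ln t))) \<in> O[at_right 0](\<lambda>t. of_real (t * ln t ^ (n + 1))))"

lemma has_log_const_iff:
  "has_log_const n f a \<longleftrightarrow> (\<exists>c. has_log_expansion n f c \<and> c 0 = a)"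
proof
  assume "has_log_const n f a"
  then obtain p where p: "degree p \<le> n" "poly p 0 = a"
    "(\<lambda>t. f t - poly p (of_real (ln t))) \<in> O[at_right 0](\<lambda>t. of_real (t * ln t ^ (n + 1)))"
    by (auto simp: has_log_const_def)
  have "poly p x = (\<Sum>k\<le>n. coeff p k * x ^ k)" for x
    unfolding poly_altdef using p(1)
    by (intro sum.mono_neutral_left) (auto simp: coeff_eq_0)
  with p show "\<exists>c. has_log_expansion n f c \<and> c 0 = a"
    by (auto simp: has_log_expansion_def poly_0_coeff_0 intro!: exI[of _ "coeff p"])
next
  assume "\<exists>c. has_log_expansion n f c \<and> c 0 = a"
  then obtain c where c: "has_log_expansion n f c" "c 0 = a" by blast
  define p where "p = (\<Sum>k\<le>n. monom (c k) k)"
  have "degree p \<le> n"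
    unfolding p_def by (intro degree_sum_le) (auto intro: order_trans[OF degree_monom_le])
  moreover have px: "poly p x = (\<Sum>k\<le>n. c k * x ^ k)" for x
    by (simp add: p_def poly_sum poly_monom)
  moreover have "poly p 0 = a"
    using c(2) by (simp add: poly_0_coeff_0 p_def coeff_sum)
  ultimately show "has_log_const n f a"
    using c(1) unfolding has_log_const_def has_log_expansion_def by (intro exI[of _ p]) simp
qed

text \<open>Here \<open>\<bar>ln t\<bar>\<close> is at least 1, so higher powers of the logarithm
  dominate lower ones.\<close>

lemma eventually_ln_le_minus_1: "eventually (\<lambda>t::real. 0 < t \<and> t < 1 \<and> ln t \<le> -1) (at_right 0)"
proof -
  have "eventually (\<lambda>t::real. t \<in> {0<..<exp (-1)}) (at_right 0)"
    by (rule eventually_at_right_real) simp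
  then show ?thesis
  proof eventually_elim
    case (elim t)
    then have "ln t < ln (exp (-1))" by (subst ln_less_cancel_iff) auto
    moreover have "exp (-1) < (1::real)" by simp
    ultimately show ?case using elim by (simp del: exp_less_one_iff) 
  qed
qed

lemma log_power_bigo:
  assumes "i \<le> j"
  shows "(\<lambda>t. of_real (ln t) ^ i :: complex) \<in> O[at_right 0](\<lambda>t. of_real (ln t ^ j))"
proof (rule bigoI[of _ 1])
  show "\<forall>\<^sub>F t in at_right 0. norm (of_real (ln t) ^ i :: complex) \<le> 1 * norm (of_real (ln t ^ j) :: complex)"
    using eventually_ln_le_minus_1
    by eventually_elim (use assms in \<open>auto simp: norm_power power_abs intro!: power_increasing\<close>)
qed

lemma poly_log_bigo:
  assumes "degree p \<le> n"
  shows "(\<lambda>t. poly p (of_real (ln t)) :: complex) \<in> O[at_right 0](\<lambda>t. of_real (ln t ^ n))"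
  unfolding poly_altdef
proof (rule big_sum_in_bigo)
  fix i assume "i \<in> {..degree p}"
  with assms have "(\<lambda>t. of_real (ln t) ^ i :: complex) \<in> O[at_right 0](\<lambda>t. of_real (ln t ^ n))"
    by (intro log_power_bigo) simp
  then show "(\<lambda>t. coeff p i * of_real (ln t) ^ i) \<in> O[at_right 0](\<lambda>t. of_real (ln t ^ n))"
    by (cases "coeff p i = 0") simp_all
qed

lemma has_log_const_mult:
  assumes f: "has_log_const m f a" and g: "has_log_const n g b"
  shows "has_log_const (m + n) (\<lambda>t. f t * g t) (a * b)"
proof -
  obtain p where p: "degree p \<le> m" "poly p 0 = a"
    "(\<lambda>t. f t - poly p (of_real (ln t))) \<in> O[at_right 0](\<lambda>t. of_real (t * ln t ^ (m + 1)))"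
    using f by (auto simp: has_log_const_def)
  obtain q where q: "degree q \<le> n" "poly q 0 = b"
    "(\<lambda>t. g t - poly q (of_real (ln t))) \<in> O[at_right 0](\<lambda>t. of_real (t * ln t ^ (n + 1)))"
    using g by (auto simp: has_log_const_def)
  let ?L = "\<lambda>t. of_real (ln t) :: complex"
  let ?R = "\<lambda>t. of_real (t * ln t ^ (m + n + 1)) :: complex"
  have "(\<lambda>t. poly p (?L t) * (g t - poly q (?L t))) \<in>
      O[at_right 0](\<lambda>t. of_real (ln t ^ m) * of_real (t * ln t ^ (n + 1)))"
    by (intro landau_o.big.mult poly_log_bigo p q)
  then have 1: "(\<lambda>t. poly p (?L t) * (g t - poly q (?L t))) \<in> O[at_right 0](?R)"
    by (simp add: power_add mult_ac)
  have "(\<lambda>t. (f t - poly p (?L t)) * poly q (?L t)) \<in>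
      O[at_right 0](\<lambda>t. of_real (t * ln t ^ (m + 1)) * of_real (ln t ^ n))"
    by (intro landau_o.big.mult poly_log_bigo p q)
  then have 2: "(\<lambda>t. (f t - poly p (?L t)) * poly q (?L t)) \<in> O[at_right 0](?R)"
    by (simp add: power_add mult_ac)
  \<comment> \<open>The product of the two errors has a spare factor t ln t, which stays
    bounded.\<close>
  have "(\<lambda>t. (f t - poly p (?L t)) * (g t - poly q (?L t))) \<in>
      O[at_right 0](\<lambda>t. of_real (t * ln t ^ (m + 1)) * of_real (t * ln t ^ (n + 1)))"
    by (intro landau_o.big.mult p q)
  also have "(\<lambda>t. of_real (t * ln t ^ (m + 1)) * of_real (t * ln t ^ (n + 1))) =
      (\<lambda>t. of_real (t * ln t) * ?R t)"
    by (auto simp: power_add mult_ac)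
  also have "\<dots> \<in> O[at_right 0](\<lambda>t. 1 * ?R t)"
  proof (intro landau_o.big.mult_right bigoI[of _ 1])
    show "\<forall>\<^sub>F t in at_right 0. norm (of_real (t * ln t) :: complex) \<le> 1 * norm (1 :: complex)"
      using eventually_ln_le_minus_1
    proof eventually_elim
      case (elim t)
      have "- ln t \<le> 1 / t - 1"
        using ln_le_minus_one[of "1 / t"] elim by (simp add: ln_div)
      then have "t * (- ln t) \<le> t * (1 / t - 1)" using elim by (intro mult_left_mono) auto
      also have "\<dots> \<le> 1" using elim by (simp add: algebra_simps)
      finally show ?case using elim by (simp add: abs_mult norm_mult)
    qed
  qed
  finally have 3: "(\<lambda>t. (f t - poly p (?L t)) * (g t - poly q (?L t))) \<in> O[at_right 0](?R)"
    by simp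
  have "(\<lambda>t. f t * g t - poly (p * q) (?L t)) =
    (\<lambda>t. poly p (?L t) * (g t - poly q (?L t)) + (f t - poly p (?L t)) * poly q (?L t)
       + (f t - poly p (?L t)) * (g t - poly q (?L t)))"
    by (auto simp: algebra_simps)
  also have "\<dots> \<in> O[at_right 0](?R)"
    by (intro sum_in_bigo 1 2 3)
  finally show ?thesis
    unfolding has_log_const_def
    using p q by (intro exI[of _ "p * q"]) (auto intro: order_trans[OF degree_mult_le])
qed

lemma has_log_const_add:
  assumes f: "has_log_const n f a" and g: "has_log_const n g b"
  shows "has_log_const n (\<lambda>t. f t + g t) (a + b)"
proof -
  obtain p where p: "degree p \<le> n" "poly p 0 = a"
    "(\<lambda>t. f t - poly p (of_real (ln t))) \<in> O[at_right 0](\<lambda>t. of_real (t * ln t ^ (n + 1)))"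
    using f by (auto simp: has_log_const_def)
  obtain q where q: "degree q \<le> n" "poly q 0 = b"
    "(\<lambda>t. g t - poly q (of_real (ln t))) \<in> O[at_right 0](\<lambda>t. of_real (t * ln t ^ (n + 1)))"
    using g by (auto simp: has_log_const_def)
  show ?thesis
    unfolding has_log_const_def
    using sum_in_bigo(1)[OF p(3) q(3)] p q
    by (intro exI[of _ "p + q"]) (auto intro: degree_add_le simp: algebra_simps)
qed

lemma has_log_const_poly:
  assumes "degree p \<le> n"
  shows "has_log_const n (\<lambda>t. poly p (of_real (ln t))) (poly p 0)"
  using assms unfolding has_log_const_def by (intro exI[of _ p]) simp

lemma has_log_const_const: "has_log_const n (\<lambda>_. a) a"
  using has_log_const_poly[of "[:a:]" n] by simp

lemma has_log_const_sum:
  assumes "\<And>k. k \<in> A \<Longrightarrow> has_log_const n (f k) (a k)"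
  shows "has_log_const n (\<lambda>t. \<Sum>k\<in>A. f k t) (\<Sum>k\<in>A. a k)"
  using assms
  by (induction A rule: infinite_finite_induct) (auto intro: has_log_const_add has_log_const_const)

lemma has_log_const_bigo:
  assumes "(\<lambda>t. f t - a) \<in> O[at_right 0](\<lambda>t. of_real t)"
  shows "has_log_const n f a"
proof -
  note assms
  also have "(\<lambda>t. of_real t) \<in> O[at_right 0](\<lambda>t. of_real (t * ln t ^ (n + 1)) :: complex)"
  proof (rule bigoI[of _ 1])
    show "\<forall>\<^sub>F t in at_right 0. norm (of_real t :: complex) \<le> 1 * norm (of_real (t * ln t ^ (n + 1)) :: complex)"
      using eventually_ln_le_minus_1
    proof eventually_elim
      case (elim t)
      then have "1 \<le> \<bar>ln t\<bar> ^ (n + 1)" by (intro one_le_power) auto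
      with elim have "\<bar>t\<bar> * 1 \<le> \<bar>t\<bar> * \<bar>ln t\<bar> ^ (n + 1)" by (intro mult_left_mono) auto
      then show ?case by (simp add: norm_mult norm_power abs_mult power_abs)
    qed
  qed
  finally show ?thesis
    unfolding has_log_const_def by (intro exI[of _ "[:a:]"]) auto
qed

text \<open>Since log t is unbounded as t tends to 0, a polynomial in log t that tends to 0 is the
  zero polynomial. This gives the \<open>THE\<close> in \<open>reg_integral\<close> its
  meaning.\<close>

lemma has_log_const_unique:
  assumes f: "has_log_const n f a" and g: "has_log_const n f b"
  shows "a = b"
proof -
  obtain p where p: "poly p 0 = a"
    "(\<lambda>t. f t - poly p (of_real (ln t))) \<in> O[at_right 0](\<lambda>t. of_real (t * ln t ^ (n + 1)))"
    using f by (auto simp: has_log_const_def)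
  obtain q where q: "poly q 0 = b"
    "(\<lambda>t. f t - poly q (of_real (ln t))) \<in> O[at_right 0](\<lambda>t. of_real (t * ln t ^ (n + 1)))"
    using g by (auto simp: has_log_const_def)
  have "(\<lambda>t. poly (q - p) (of_real (ln t))) \<in> O[at_right 0](\<lambda>t. of_real (t * ln t ^ (n + 1)))"
    using sum_in_bigo(2)[OF p(2) q(2)] by simp
  moreover have "((\<lambda>t::real. of_real (t * ln t ^ (n + 1)) :: complex) \<longlongrightarrow> of_real 0) (at_right 0)"
    by (rule tendsto_of_real) real_asymp
  ultimately have lim: "((\<lambda>t. poly (q - p) (of_real (ln t))) \<longlongrightarrow> 0) (at_right 0)"
    unfolding of_real_0 by (rule bigo_tendsto_0)
  have "degree (q - p) = 0"
  proof (rule ccontr)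
    assume "degree (q - p) \<noteq> 0"
    then have "filterlim (poly (q - p)) at_infinity at_infinity"
      by (intro filterlim_poly_at_infinity) simp
    moreover have "filterlim (\<lambda>t::real. of_real (ln t) :: complex) at_infinity (at_right 0)"
    proof (rule filterlim_norm_at_top_imp_at_infinity)
      have "filterlim (\<lambda>t::real. norm (ln t)) at_top (at_right 0)"
        by (intro filterlim_at_infinity_imp_norm_at_top filterlim_at_bot_imp_at_infinity ln_at_0)
      then show "filterlim (\<lambda>t::real. norm (of_real (ln t) :: complex)) at_top (at_right 0)"
        by simp
    qed
    ultimately have "filterlim (\<lambda>t. poly (q - p) (of_real (ln t))) at_infinity (at_right 0)"
      by (rule filterlim_compose)
    with lim show False
      using not_tendsto_and_filterlim_at_infinity[of "at_right (0::real)"] by auto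
  qed
  then obtain d where d: "q - p = [:d:]" by (rule degree_eq_zeroE)
  with lim have "d = 0" by (simp add: tendsto_const_iff)
  with d have "q = p" by simp
  with p q show ?thesis by simp
qed

lemma has_log_const_cong:
  assumes "has_log_const n f a" "eventually (\<lambda>t. f t = g t) (at_right 0)"
  shows "has_log_const n g a"
proof -
  have "(\<lambda>t. f t - h t) \<in> O[at_right 0](k) \<longleftrightarrow> (\<lambda>t. g t - h t) \<in> O[at_right 0](k)"
    for h k :: "real \<Rightarrow> complex"
    by (rule landau_o.big.in_cong) (use assms(2) in \<open>auto elim: eventually_mono\<close>)
  with assms(1) show ?thesis unfolding has_log_const_def by simp
qed

section \<open>Regularized values of series\<close>

definition nc_regularizes :: "(real \<Rightarrow> complex ncps) \<Rightarrow> complex ncps \<Rightarrow> bool" where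
  "nc_regularizes F A \<longleftrightarrow> (\<forall>w. has_log_const (length w) (\<lambda>t. nc_coeff (F t) w) (nc_coeff A w))"

lemma nc_regularizes_const: "nc_regularizes (\<lambda>_. A) A"
  by (simp add: nc_regularizes_def has_log_const_const)

text \<open>The order of the expansion at a word is its length, and lengths add when a word is
  split, so every term of the product has the required order.\<close>

lemma nc_regularizes_mult:
  assumes "nc_regularizes F A" "nc_regularizes G B"
  shows "nc_regularizes (\<lambda>t. F t * G t) (A * B)"
  unfolding nc_regularizes_def nc_coeff_mult
proof (intro allI has_log_const_sum)
  fix w :: "bool list" and k assume "k \<in> {..length w}"
  then have "length w = length (take k w) + length (drop k w)" by simp
  then show "has_log_const (length w) (\<lambda>t. nc_coeff (F t) (take k w) * nc_coeff (G t) (drop k w))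
      (nc_coeff A (take k w) * nc_coeff B (drop k w))"
    using assms has_log_const_mult unfolding nc_regularizes_def by metis
qed

lemma nc_regularizes_eps:
  assumes "nc_regularizes F A"
  shows "nc_regularizes (\<lambda>t. nc_eps (F t)) (nc_eps A)"
  unfolding nc_regularizes_def
proof
  fix w :: "bool list"
  have "has_log_const (length w) (\<lambda>t. nc_coeff (F t) (rev w)) (nc_coeff A (rev w))"
    using assms unfolding nc_regularizes_def by (metis length_rev)
  from has_log_const_mult[OF has_log_const_const[of 0] this]
  show "has_log_const (length w) (\<lambda>t. nc_coeff (nc_eps (F t)) w) (nc_coeff (nc_eps A) w)"
    by simp
qed

lemma nc_regularizes_unique:
  "nc_regularizes F A \<Longrightarrow> nc_regularizes F B \<Longrightarrow> A = B"
  by (rule ncps_eqI) (auto simp: nc_regularizes_def intro: has_log_const_unique)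

lemma nc_regularizes_cong:
  assumes "nc_regularizes F A" "eventually (\<lambda>t. F t = G t) (at_right 0)"
  shows "nc_regularizes G A"
  unfolding nc_regularizes_def
proof
  fix w
  from assms(1) have "has_log_const (length w) (\<lambda>t. nc_coeff (F t) w) (nc_coeff A w)"
    by (simp add: nc_regularizes_def)
  then show "has_log_const (length w) (\<lambda>t. nc_coeff (G t) w) (nc_coeff A w)"
    by (rule has_log_const_cong) (use assms(2) in eventually_elim, simp)
qed

text \<open>Only small \<open>t\<close> matter, so the integrals are compared only while both limits
  lie in the straight quarters of a path.\<close>

lemma reg_integral_eqI:
  assumes "nc_regularizes F A"
    and "\<And>t. 0 < t \<Longrightarrow> t < 1/4 \<Longrightarrow> iterated_integral g (map of_bool w) t (1 - t) = nc_coeff (F t) w"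
  shows "reg_integral g (map of_bool w) = nc_coeff A w"
proof -
  have "eventually (\<lambda>t::real. t \<in> {0<..<1/4}) (at_right 0)"
    by (rule eventually_at_right_real) simp
  then have "eventually (\<lambda>t. nc_coeff (F t) w = iterated_integral g (map of_bool w) t (1 - t)) (at_right 0)"
    by eventually_elim (simp add: assms(2))
  with assms(1) have "has_log_const (length w) (\<lambda>t. iterated_integral g (map of_bool w) t (1 - t)) (nc_coeff A w)"
    unfolding nc_regularizes_def by (blast intro: has_log_const_cong)
  then show ?thesis
    unfolding reg_integral_def has_log_const_iff[symmetric] length_map
    by (intro the_equality) (auto intro: has_log_const_unique)
qed

text \<open>Each coefficient is 0 or a multiple of a pure power of log t, with constant term 0
  unless the word is empty.\<close>

lemma nc_regularizes_exp: "nc_regularizes (\<lambda>t. nc_exp (c * of_real (ln t)) a) 1"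
  unfolding nc_regularizes_def
proof
  fix w :: "bool list"
  define p where "p = (if set w \<subseteq> {a} then monom (c ^ length w / fact (length w)) (length w) else 0)"
  have "degree p \<le> length w" by (simp add: p_def degree_monom_le)
  moreover have "poly p (of_real (ln t)) = nc_coeff (nc_exp (c * of_real (ln t)) a) w" for t
    by (simp add: p_def nc_coeff_exp poly_monom power_mult_distrib)
  moreover have "poly p 0 = nc_coeff 1 w"
    by (auto simp: p_def poly_monom)
  ultimately show "has_log_const (length w) (\<lambda>t. nc_coeff (nc_exp (c * of_real (ln t)) a) w) (nc_coeff 1 w)"
    using has_log_const_poly[of p "length w"] by simp
qed

section \<open>Local solutions at the punctures\<close>

text \<open>The equation satisfied by the coefficient \<open>r\<close> at \<open>w\<close>, given the coefficients \<open>p\<close> at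
  shorter words, of the holomorphic factor \<open>P\<close> in the solution \<open>P(s) exp(- log s X\<^sub>c)\<close>.\<close>

definition local_coeff ::
    "bool \<Rightarrow> (bool list \<Rightarrow> complex \<Rightarrow> complex) \<Rightarrow> bool list \<Rightarrow> (complex \<Rightarrow> complex) \<Rightarrow> bool" where
  "local_coeff c p w r \<longleftrightarrow> r holomorphic_on ball 0 1 \<and> r 0 = (if w = [] then 1 else 0) \<and>
     (\<forall>s\<in>ball 0 1 - {0}. (r has_field_derivative
        (if w \<noteq> [] \<and> last w = c then p (butlast w) s / s else 0)
        - (if w \<noteq> [] then (if hd w = c then 1 / s else 1 / (s - 1)) * p (tl w) s else 0)) (at s))"

text \<open>Solve word by word: the derivative prescribed at \<open>w\<close> involves shorter words
  only, its apparent pole at 0 is removable, and holomorphic functions on a disc have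
  primitives.\<close>

lemma ex_local_coeff: "\<exists>p. \<forall>w. local_coeff c p w (p w)"
proof (rule dependent_wf_choice[OF wf_measure[of length]])
  fix f g :: "bool list \<Rightarrow> complex \<Rightarrow> complex" and w r
  assume *: "\<And>v. (v, w) \<in> Wellfounded.measure length \<Longrightarrow> f v = g v"
  have "f (butlast w) = g (butlast w) \<and> f (tl w) = g (tl w)" if "w \<noteq> []"
    using that by (intro conjI *) auto
  then show "local_coeff c f w r = local_coeff c g w r"
    by (cases "w = []") (simp_all add: local_coeff_def)
next
  fix w :: "bool list" and p :: "bool list \<Rightarrow> complex \<Rightarrow> complex"
  assume IH: "\<And>v. (v, w) \<in> Wellfounded.measure length \<Longrightarrow> local_coeff c p v (p v)"
  show "\<exists>r. local_coeff c p w r"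
  proof (cases "w = []")
    case True
    then show ?thesis by (intro exI[of _ "\<lambda>_. 1"]) (simp add: local_coeff_def)
  next
    case False
    have hol: "p (tl w) holomorphic_on ball 0 1" "p (butlast w) holomorphic_on ball 0 1"
      and p0: "p (tl w) 0 = (if tl w = [] then 1 else 0)" "p (butlast w) 0 = (if butlast w = [] then 1 else 0)"
      using IH[of "tl w"] IH[of "butlast w"] False by (auto simp: local_coeff_def)
    \<comment> \<open>\<open>q s / s\<close> collects the terms with a pole at 0.\<close>
    define q where "q s = (if last w = c then p (butlast w) s else 0) - (if hd w = c then p (tl w) s else 0)" for s
    \<comment> \<open>A single letter is both first and last, so the two contributions of the empty
      word cancel; for longer words both values at 0 vanish.\<close>
    have q0: "q 0 = 0"
      using False p0 by (cases w) (auto simp: q_def)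
    have "q holomorphic_on ball 0 1"
      unfolding q_def using hol by (cases "last w = c"; cases "hd w = c") (auto intro!: holomorphic_intros)
    then have "(\<lambda>z. if z = 0 then deriv q 0 else (q z - q 0) / (z - 0)) holomorphic_on ball 0 1"
      by (rule pole_lemma_open) simp
    moreover have "(\<lambda>s. if hd w = c then 0 else p (tl w) s / (s - 1)) holomorphic_on ball 0 1"
      using hol by (cases "hd w = c") (auto intro!: holomorphic_intros)
    ultimately have "(\<lambda>z. (if z = 0 then deriv q 0 else (q z - q 0) / (z - 0))
        - (if hd w = c then 0 else p (tl w) z / (z - 1))) holomorphic_on ball 0 1" (is "?h holomorphic_on _")
      by (rule holomorphic_on_diff)
    then obtain r where r: "\<And>s. s \<in> ball 0 1 \<Longrightarrow> (r has_field_derivative ?h s) (at s within ball 0 1)"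
      using holomorphic_convex_primitive'[of "ball 0 1" ?h] by (auto simp del: mem_ball)
    \<comment> \<open>The shift by \<open>r 0\<close> makes the coefficient vanish at 0, as P(0) = 1
      requires at a nonempty word.\<close>
    have r': "((\<lambda>s. r s - r 0) has_field_derivative ?h s) (at s)" if "s \<in> ball 0 1" for s
      using DERIV_diff[OF r[OF that] DERIV_const[of "r 0"]] that
      by (simp add: at_within_open[of _ "ball 0 1"])
    have "(\<lambda>s. r s - r 0) holomorphic_on ball 0 1"
      by (rule holomorphic_onI) (use r' in \<open>auto simp: field_differentiable_def intro: has_field_derivative_at_within\<close>)
    moreover have "((\<lambda>s. r s - r 0) has_field_derivative
        (if w \<noteq> [] \<and> last w = c then p (butlast w) s / s else 0)
        - (if w \<noteq> [] then (if hd w = c then 1 / s else 1 / (s - 1)) * p (tl w) s else 0)) (at s)"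
      if s: "s \<in> ball 0 1 - {0}" for s
    proof -
      have "?h s = (if w \<noteq> [] \<and> last w = c then p (butlast w) s / s else 0)
        - (if w \<noteq> [] then (if hd w = c then 1 / s else 1 / (s - 1)) * p (tl w) s else 0)"
        using s False by (simp add: q0 q_def[of s] diff_divide_distrib)
      with r'[of s] s show ?thesis by (simp only: Diff_iff)
    qed
    ultimately show ?thesis
      using False by (intro exI[of _ "\<lambda>s. r s - r 0"]) (simp add: local_coeff_def del: mem_ball)
  qed
qed

definition nc_local :: "bool \<Rightarrow> complex \<Rightarrow> complex ncps" where
  "nc_local c s = Abs_ncps (\<lambda>w. (SOME p. \<forall>w. local_coeff c p w (p w)) w s)"

text \<open>The summand P X_c / s in the derivative cancels what the factor exp(- log s X_c)
  contributes, which leaves only the connection acting from the left.\<close>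

lemma nc_local:
  "(\<lambda>s. nc_coeff (nc_local c s) w) holomorphic_on ball 0 1"
  "nc_local c 0 = 1"
  "s \<in> ball 0 1 - {0} \<Longrightarrow> ((\<lambda>s. nc_coeff (nc_local c s) w) has_field_derivative
     nc_coeff (nc_scale (1 / s) (nc_local c s * nc_var c)
       - (nc_scale (1 / s) (nc_var c) + nc_scale (1 / (s - 1)) (nc_var (\<not> c))) * nc_local c s) w) (at s)"
proof -
  note * = someI_ex[OF ex_local_coeff[of c], rule_format, unfolded local_coeff_def]
  show "(\<lambda>s. nc_coeff (nc_local c s) w) holomorphic_on ball 0 1"
    unfolding nc_local_def nc_coeff_Abs local_coeff_def using *[of w] by blast
  show "nc_local c 0 = 1"
    by (rule ncps_eqI) (simp add: nc_local_def local_coeff_def *)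
  assume s: "s \<in> ball 0 1 - {0}"
  have "nc_coeff (nc_scale (1 / s) (nc_local c s * nc_var c)
       - (nc_scale (1 / s) (nc_var c) + nc_scale (1 / (s - 1)) (nc_var (\<not> c))) * nc_local c s) w
    = (if w \<noteq> [] \<and> last w = c then nc_coeff (nc_local c s) (butlast w) / s else 0)
        - (if w \<noteq> [] then (if hd w = c then 1 / s else 1 / (s - 1)) * nc_coeff (nc_local c s) (tl w) else 0)"
    by (auto simp: nc_coeff_mult_var distrib_right nc_scale_mult_left nc_coeff_var_mult)
  then show "((\<lambda>s. nc_coeff (nc_local c s) w) has_field_derivative
     nc_coeff (nc_scale (1 / s) (nc_local c s * nc_var c)
       - (nc_scale (1 / s) (nc_var c) + nc_scale (1 / (s - 1)) (nc_var (\<not> c))) * nc_local c s) w) (at s)"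
    unfolding nc_local_def nc_coeff_Abs local_coeff_def using *[of w] s by simp
qed

text \<open>The coordinate \<open>s\<close> with \<open>z = of_bool c + side c * s\<close> puts the puncture \<open>of_bool c\<close> at 0 and
  the other one at 1, with the tangent vector of the base point equal to 1.\<close>

definition side :: "bool \<Rightarrow> complex" where "side c = (if c then -1 else 1)"

definition base :: "bool \<Rightarrow> complex \<times> complex" where "base c = (of_bool c, side c)"

lemma base_simps: "base False = base0" "base True = base1"
  by (simp_all add: base_def side_def base0_def base1_def)

text \<open>The connection form pulls back under z = 1 - s to itself with the two letters exchanged,
  so one local theory serves both punctures.\<close>

lemma nc_conn_local:
  assumes "s \<noteq> 0" "s \<noteq> 1"
  shows "nc_scale (side c) (nc_conn (of_bool c + side c * s)) =
    nc_scale (1 / s) (nc_var c) + nc_scale (1 / (s - 1)) (nc_var (\<not> c))"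
  by (rule ncps_eqI) (use assms in \<open>auto simp: nc_conn_def side_def divide_simps\<close>)

text \<open>The logarithm enters as an arbitrary function \<open>l\<close>: this covers both the
  real logarithm on a straight end and its continuation along a circle around the puncture.\<close>

lemma horizontal_local:
  assumes cont: "continuous_on {a..b} l"
    and der: "\<And>t. t \<in> {a<..<b} \<Longrightarrow> (l has_vector_derivative l' t) (at t)"
    and norm: "\<And>t. t \<in> {a..b} \<Longrightarrow> norm (exp (l t)) < 1"
  shows "horizontal (\<lambda>t. of_bool c + side c * exp (l t))
    (\<lambda>t. nc_local c (exp (l t)) * nc_exp (- l t) c) a b"
  unfolding horizontal_def
proof (intro conjI exI[of _ "{}"] ballI)
  have "continuous_on {a..b} (\<lambda>t. nc_coeff (nc_local c (exp (l t))) w)" for w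
    by (rule continuous_on_compose2[OF holomorphic_on_imp_continuous_on[OF nc_local(1)]])
      (use norm in \<open>auto intro!: continuous_intros cont\<close>)
  moreover have "continuous_on {a..b} (\<lambda>t. nc_coeff (nc_exp (- l t) c) w)" for w
    unfolding nc_coeff_exp by (cases "set w \<subseteq> {c}") (auto intro!: continuous_intros cont)
  ultimately show "nc_continuous_on {a..b} (\<lambda>t. nc_local c (exp (l t)) * nc_exp (- l t) c)"
    by (intro nc_continuous_on_mult) (simp_all add: nc_continuous_on_def)
  fix t assume t: "t \<in> {a<..<b} - {}"
  let ?s = "exp (l t)"
  have exp: "((\<lambda>t. exp (l t)) has_vector_derivative l' t * ?s) (at t)"
    using field_vector_diff_chain_at[OF der DERIV_exp] t by (simp add: o_def)
  have "norm ?s < 1" using norm[of t] t by (simp del: norm_exp_eq_Re)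
  then have s: "?s \<in> ball 0 1 - {0}" "?s \<noteq> 0" "?s \<noteq> 1"
    by (simp_all del: norm_exp_eq_Re) (metis less_irrefl norm_one)
  let ?W = "nc_scale (1 / ?s) (nc_var c) + nc_scale (1 / (?s - 1)) (nc_var (\<not> c))"
  have 1: "nc_has_deriv (\<lambda>t. nc_local c (exp (l t)))
    (nc_scale (l' t * ?s) (nc_scale (1 / ?s) (nc_local c ?s * nc_var c) - ?W * nc_local c ?s)) t"
    unfolding nc_has_deriv_def
  proof
    fix w
    from field_vector_diff_chain_at[OF exp nc_local(3)[OF s(1), of c w]]
    show "((\<lambda>t. nc_coeff (nc_local c (exp (l t))) w) has_vector_derivative
       nc_coeff (nc_scale (l' t * ?s) (nc_scale (1 / ?s) (nc_local c ?s * nc_var c) - ?W * nc_local c ?s)) w) (at t)"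
      by (simp add: o_def)
  qed
  have "((\<lambda>t. - l t) has_vector_derivative - l' t) (at t)"
    using der[of t] t by (intro has_vector_derivative_minus) auto
  then have 2: "nc_has_deriv (\<lambda>t. nc_exp (- l t) c) (nc_scale (- l' t) (nc_var c * nc_exp (- l t) c)) t"
    by (rule nc_has_deriv_exp)
  have "((\<lambda>t. of_bool c + side c * exp (l t)) has_vector_derivative side c * (l' t * ?s)) (at t)"
    using has_vector_derivative_add[OF has_vector_derivative_const has_vector_derivative_mult_right[OF exp]]
    by simp
  moreover have "nc_scale (l' t * ?s) (nc_scale (1 / ?s) (nc_local c ?s * nc_var c) - ?W * nc_local c ?s)
      * nc_exp (- l t) c
      + nc_local c ?s * nc_scale (- l' t) (nc_var c * nc_exp (- l t) c)
    = - nc_scale (side c * (l' t * ?s)) (nc_conn (of_bool c + side c * ?s) * (nc_local c ?s * nc_exp (- l t) c))"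
  proof -
    have "nc_scale (side c * (l' t * ?s)) (nc_conn (of_bool c + side c * ?s) * (nc_local c ?s * nc_exp (- l t) c))
      = nc_scale (l' t * ?s) (nc_scale (side c) (nc_conn (of_bool c + side c * ?s)) * (nc_local c ?s * nc_exp (- l t) c))"
      by (rule ncps_eqI) (simp add: nc_scale_mult_left)
    also have "\<dots> = nc_scale (l' t * ?s) (?W * nc_local c ?s * nc_exp (- l t) c)"
      by (simp only: nc_conn_local[OF s(2,3)] mult.assoc)
    finally have *: "nc_scale (side c * (l' t * ?s))
        (nc_conn (of_bool c + side c * ?s) * (nc_local c ?s * nc_exp (- l t) c))
      = nc_scale (l' t * ?s) (?W * nc_local c ?s * nc_exp (- l t) c)" .
    show ?thesis
      unfolding *
      by (rule ncps_eqI)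
        (simp add: nc_scale_mult_left nc_scale_mult_right left_diff_distrib mult.assoc right_diff_distrib)
  qed
  ultimately show "\<exists>D. ((\<lambda>t. of_bool c + side c * exp (l t)) has_vector_derivative D) (at t) \<and>
     nc_has_deriv (\<lambda>t. nc_local c (exp (l t)) * nc_exp (- l t) c)
       (- nc_scale D (nc_conn (of_bool c + side c * exp (l t)) * (nc_local c (exp (l t)) * nc_exp (- l t) c))) t"
    using nc_has_deriv_mult[OF 1 2] by auto
qed simp

definition nc_end :: "bool \<Rightarrow> real \<Rightarrow> complex ncps" where
  "nc_end c t = nc_local c (of_real t) * nc_exp (- of_real (ln t)) c"

lemma horizontal_end:
  assumes "0 < a" "b < 1" and g: "\<And>t. t \<in> {a..b} \<Longrightarrow> g t = of_bool c + side c * of_real t"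
  shows "horizontal g (nc_end c) a b"
proof -
  have e: "exp (of_real (ln t)) = complex_of_real t" if "t \<in> {a..b}" for t
    using that assms by (simp add: exp_of_real)
  have "horizontal (\<lambda>t. of_bool c + side c * exp (of_real (ln t)))
     (\<lambda>t. nc_local c (exp (of_real (ln t))) * nc_exp (- of_real (ln t)) c) a b"
  proof (rule horizontal_local)
    show "continuous_on {a..b} (\<lambda>t. complex_of_real (ln t))"
      using assms by (auto intro!: continuous_intros)
    show "((\<lambda>t. complex_of_real (ln t)) has_vector_derivative of_real (1 / t)) (at t)"
      if "t \<in> {a<..<b}" for t
      using that assms
      by (auto intro!: has_vector_derivative_of_real derivative_eq_intros
          simp flip: has_real_derivative_iff_has_vector_derivative)
    show "norm (exp (complex_of_real (ln t))) < 1" if "t \<in> {a..b}" for t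
      using that assms by (simp add: e)
  qed
  then show ?thesis
    by (rule horizontal_cong) (auto simp: g e nc_end_def)
qed

lemma horizontal_end_reflected:
  assumes "0 < a" "b < 1" and g: "\<And>t. t \<in> {a..b} \<Longrightarrow> g t = of_bool c + side c * of_real (1 - t)"
  shows "horizontal g (\<lambda>t. nc_end c (1 - t)) a b"
proof -
  have "horizontal (\<lambda>t. of_bool c + side c * of_real t) (nc_end c) (1 - b) (1 - a)"
    by (rule horizontal_end) (use assms in auto)
  then have "horizontal (\<lambda>t. of_bool c + side c * of_real ((- 1) * t + 1)) (\<lambda>t. nc_end c ((- 1) * t + 1)) a b"
    by (rule horizontal_affine) auto
  then show ?thesis
    by (rule horizontal_cong) (auto simp: g)
qed

text \<open>P is differentiable at 0 with value 1, so P(t) - 1 is O(t), and the exponential factor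
  has regularized value 1.\<close>

lemma nc_regularizes_end: "nc_regularizes (nc_end c) 1"
proof -
  have "nc_regularizes (\<lambda>t. nc_local c (of_real t)) 1"
    unfolding nc_regularizes_def
  proof (intro allI has_log_const_bigo)
    fix w
    let ?f = "\<lambda>s. nc_coeff (nc_local c s) w"
    have f0: "?f 0 = nc_coeff 1 w" by (simp only: nc_local(2))
    obtain D where D: "(?f has_field_derivative D) (at 0)"
      using holomorphic_on_imp_differentiable_at[OF nc_local(1)[of c w], of 0]
      by (auto simp: field_differentiable_def)
    have "((\<lambda>t. (?f (of_real t) - ?f 0) / of_real t) \<longlongrightarrow> D) (at_right 0)"
    proof -
      have "((\<lambda>z. (?f z - ?f 0) / z) \<longlongrightarrow> D) (at 0)"
        using D by (simp add: has_field_derivative_iff)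
      moreover have "filterlim complex_of_real (at 0) (at_right 0)"
        by (auto simp: filterlim_at eventually_at_filter intro!: tendsto_eq_intros)
      ultimately show ?thesis by (rule filterlim_compose)
    qed
    then have "(\<lambda>t. ?f (of_real t) - ?f 0) \<in> O[at_right 0](\<lambda>t. of_real t)"
      by (rule bigoI_tendsto) (auto simp: eventually_at_filter)
    then show "(\<lambda>t. ?f (of_real t) - nc_coeff 1 w) \<in> O[at_right 0](\<lambda>t. of_real t)"
      by (simp only: f0)
  qed
  from nc_regularizes_mult[OF this nc_regularizes_exp[of "-1" c]]
  show ?thesis by (simp add: nc_end_def[abs_def])
qed

text \<open>The pairing is constant in \<open>t\<close>, and a constant is its own regularized
  value; by the behaviour at 0 that value is \<open>nc_eps 1 * 1\<close>.\<close>

lemma nc_eps_end: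
  assumes "0 < t" "t < 1"
  shows "nc_eps (nc_end c t) * nc_end c t = 1"
proof -
  have "nc_eps (nc_end c u) * nc_end c u = nc_eps (nc_end c t) * nc_end c t" if "0 < u" "u < t" for u
    by (rule horizontal_pairing_const[OF horizontal_end horizontal_end]) (use that assms in auto)
  moreover have "eventually (\<lambda>u::real. u \<in> {0<..<t}) (at_right 0)"
    by (rule eventually_at_right_real) (use assms in simp)
  ultimately have "eventually (\<lambda>u. nc_eps (nc_end c u) * nc_end c u = nc_eps (nc_end c t) * nc_end c t) (at_right 0)"
    by (auto elim: eventually_mono)
  with nc_regularizes_mult[OF nc_regularizes_eps[OF nc_regularizes_end[of c]] nc_regularizes_end[of c]]
  have "nc_regularizes (\<lambda>_. nc_eps (nc_end c t) * nc_end c t) (nc_eps 1 * 1)"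
    by (rule nc_regularizes_cong)
  from nc_regularizes_unique[OF this nc_regularizes_const] show ?thesis by (simp add: nc_eps_one)
qed

section \<open>Transport between tangential base points\<close>

text \<open>The normalization at the start of the path makes \<open>M\<close> the regularized generating series.\<close>

definition transport :: "bool \<Rightarrow> (real \<Rightarrow> complex) \<Rightarrow> bool \<Rightarrow> complex ncps \<Rightarrow> bool" where
  "transport c g d M \<longleftrightarrow> (\<exists>F. (\<forall>e>0. horizontal g F e (1 - e)) \<and>
     (\<forall>t. 0 < t \<longrightarrow> t \<le> 1/4 \<longrightarrow> F t = nc_end c t \<and> F (1 - t) = nc_end d t * nc_eps M))"

text \<open>The pairing of the section with itself is 1 at time 1/4 and \<open>M * nc_eps M\<close>
  at time 3/4.\<close>

lemma transport_unitary:
  assumes "transport c g d M"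
  shows "M * nc_eps M = 1"
proof -
  obtain F where F: "\<And>e. e > 0 \<Longrightarrow> horizontal g F e (1 - e)"
    "\<And>t. 0 < t \<Longrightarrow> t \<le> 1/4 \<Longrightarrow> F t = nc_end c t \<and> F (1 - t) = nc_end d t * nc_eps M"
    using assms unfolding transport_def by blast
  have "nc_eps (F (1/4)) * F (1/4) = nc_eps (F (1 - 1/4)) * F (1 - 1/4)"
    by (rule horizontal_pairing_const[OF F(1) F(1), of "1/4"]) auto
  also have "\<dots> = M * (nc_eps (nc_end d (1/4)) * nc_end d (1/4)) * nc_eps M"
    using F(2)[of "1/4"] by (simp add: nc_eps_mult mult.assoc)
  finally show ?thesis
    using F(2)[of "1/4"] by (simp add: nc_eps_end)
qed

text \<open>The constant coefficient of \<open>M\<close> squares to 1. Scaling both factors by it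
  makes their constant coefficients 1 and leaves both products unchanged.\<close>

lemma eps_unitary:
  fixes M :: "complex ncps"
  assumes "M * nc_eps M = 1"
  shows "nc_eps M * M = 1"
proof -
  have "nc_coeff (M * nc_eps M) [] = 1" by (simp only: assms) simp
  then have *: "nc_coeff M [] * nc_coeff M [] = 1" by simp
  have "nc_coeff (nc_scale (nc_coeff M []) M) [] = 1"
    using * by simp
  moreover have "nc_scale (nc_coeff M []) (nc_eps M) * nc_scale (nc_coeff M []) M
      = nc_scale (nc_coeff M [] * nc_coeff M []) (nc_eps M * M)"
    "nc_scale (nc_coeff M []) M * nc_scale (nc_coeff M []) (nc_eps M)
      = nc_scale (nc_coeff M [] * nc_coeff M []) (M * nc_eps M)"
    by (rule ncps_eqI, simp add: nc_scale_mult_left nc_scale_mult_right)+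
  moreover have "nc_coeff (nc_scale (nc_coeff M []) (nc_eps M)) [] = 1"
    using * by simp
  moreover have "nc_scale 1 f = f" for f :: "complex ncps"
    by (rule ncps_eqI) simp
  ultimately show ?thesis
    using nc_left_inverse_imp_right_inverse[of "nc_scale (nc_coeff M []) M" "nc_scale (nc_coeff M []) (nc_eps M)"] *
    by (simp add: assms)
qed

text \<open>Right multiplication by the inverse of \<open>F (1 - t)\<close> makes the section equal
  to 1 at \<open>1 - t\<close>. Its value at \<open>t\<close> is then
  \<open>nc_end c t * M * nc_eps (nc_end d t)\<close>, whose outer factors regularize to 1.\<close>

lemma reg_integral_transport:
  assumes "transport c g d M"
  shows "reg_integral g (map of_bool w) = nc_coeff M w"
proof -
  obtain F where F: "\<And>e. e > 0 \<Longrightarrow> horizontal g F e (1 - e)"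
    "\<And>t. 0 < t \<Longrightarrow> t \<le> 1/4 \<Longrightarrow> F t = nc_end c t \<and> F (1 - t) = nc_end d t * nc_eps M"
    using assms unfolding transport_def by blast
  have "nc_regularizes (\<lambda>t. nc_end c t * nc_eps (nc_end d t * nc_eps M)) (1 * nc_eps (1 * nc_eps M))"
    by (intro nc_regularizes_mult nc_regularizes_eps nc_regularizes_end nc_regularizes_const)
  then have "nc_regularizes (\<lambda>t. nc_end c t * nc_eps (nc_end d t * nc_eps M)) M"
    by simp
  then show ?thesis
  proof (rule reg_integral_eqI)
    fix t :: real assume t: "0 < t" "t < 1/4"
    let ?K = "nc_eps (F (1 - t))"
    have "nc_eps (nc_end d t * nc_eps M) * (nc_end d t * nc_eps M) =
        M * (nc_eps (nc_end d t) * nc_end d t) * nc_eps M"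
      by (simp add: nc_eps_mult mult.assoc)
    also have "\<dots> = 1"
      using nc_eps_end[of t d] t transport_unitary[OF assms] by simp
    finally have "?K * F (1 - t) = 1" using F(2)[of t] t by simp
    then have "F (1 - t) * ?K = 1"
      using eps_unitary[of "?K"] by simp
    moreover have "horizontal g (\<lambda>s. F s * ?K) t (1 - t)"
      by (intro horizontal_mult_right F(1) t)
    ultimately have "iterated_integral g (map of_bool w) t (1 - t) = nc_coeff (F t * ?K) w"
      using t by (intro iterated_integral_horizontal) auto
    then show "iterated_integral g (map of_bool w) t (1 - t) =
        nc_coeff (nc_end c t * nc_eps (nc_end d t * nc_eps M)) w"
      using F(2)[of t] t by simp
  qed
qed

text \<open>Near its ends the path is straight, so only the middle half has to be supplied.\<close>

lemma transport_from_middle: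
  assumes g: "tangential_path (base c) g (base d)"
    and h: "horizontal g F (1/4) (3/4)"
    and ends: "F (1/4) = nc_end c (1/4)" "F (3/4) = nc_end d (1/4) * nc_eps M"
  shows "transport c g d M"
proof -
  note G = tangential_pathD[OF g]
  define H where "H t = (if t \<le> 3/4 then if t \<le> 1/4 then nc_end c t else F t else nc_end d (1 - t) * nc_eps M)" for t
  have "horizontal g H e (1 - e)" if e: "0 < e" for e
  proof -
    \<comment> \<open>Gluing needs the two straight pieces to reach the times 1/4 and 3/4; for
      larger \<open>e\<close> the result is restricted afterwards.\<close>
    define \<delta> where "\<delta> = min e (1/4)"
    have \<delta>: "0 < \<delta>" "\<delta> \<le> e" "\<delta> \<le> 1/4" using e by (auto simp: \<delta>_def)
    have "horizontal g (nc_end c) \<delta> (1/4)"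
      by (rule horizontal_end) (use \<delta> G(2) in \<open>auto simp: base_def mult.commute\<close>)
    moreover have "horizontal g (\<lambda>t. nc_end d (1 - t) * nc_eps M) (3/4) (1 - \<delta>)"
      by (intro horizontal_mult_right horizontal_end_reflected)
        (use \<delta> G(3) in \<open>auto simp: base_def mult.commute\<close>)
    ultimately have "horizontal g H \<delta> (1 - \<delta>)"
      unfolding H_def[abs_def] using h ends \<delta>
      by (intro horizontal_append) auto
    then show ?thesis
      by (rule horizontal_subinterval) (use \<delta> in auto)
  qed
  moreover have "H t = nc_end c t \<and> H (1 - t) = nc_end d t * nc_eps M" if "0 < t" "t \<le> 1/4" for t
    using that ends by (cases "t = 1/4"; hypsubst?) (auto simp: H_def)
  ultimately show ?thesis unfolding transport_def by blast
qed

text \<open>Closing squeezes the join into the middle half of the time interval, so the middle half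
  of each factor is run through at double speed.\<close>

lemma tangential_join_eq:
  assumes "t \<in> {1/4..3/4}" "g (3/4) = h (1/4)"
  shows "tangential_join x g h y t = (if t = 1/4 then fst x + snd x / 4
    else if t \<le> 1/2 then g (2 * t - 1/4) else h (2 * t - 3/4))"
proof (cases "t = 1/4")
  case True
  show ?thesis unfolding True by (simp add: tangential_join_def tangential_close_def)
next
  case False
  then show ?thesis
    using assms
    by (auto simp: tangential_join_def tangential_close_def joinpaths_def subpath_def field_simps
        intro!: arg_cong[of _ _ g] arg_cong[of _ _ h])
qed

text \<open>\<open>G\<close> is multiplied by \<open>nc_eps M\<close> to agree with \<open>F\<close>
  at the joint. The far end then carries \<open>nc_eps N * nc_eps M\<close>, and \<epsilon> reverses
  products.\<close>

lemma transport_join: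
  assumes g: "tangential_path (base c) g (base d)" "transport c g d M"
    and h: "tangential_path (base d) h (base e)" "transport d h e N"
  shows "transport c (tangential_join (base c) g h (base e)) e (M * N)"
proof -
  let ?j = "tangential_join (base c) g h (base e)"
  obtain F where F: "\<And>e. e > 0 \<Longrightarrow> horizontal g F e (1 - e)"
    "\<And>t. 0 < t \<Longrightarrow> t \<le> 1/4 \<Longrightarrow> F t = nc_end c t \<and> F (1 - t) = nc_end d t * nc_eps M"
    using g unfolding transport_def by blast
  obtain G where G: "\<And>e. e > 0 \<Longrightarrow> horizontal h G e (1 - e)"
    "\<And>t. 0 < t \<Longrightarrow> t \<le> 1/4 \<Longrightarrow> G t = nc_end d t \<and> G (1 - t) = nc_end e t * nc_eps N"
    using h unfolding transport_def by blast
  note g' = tangential_pathD[OF g(1)] and h' = tangential_pathD[OF h(1)]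
  have mid: "g (3/4) = h (1/4)" using g'(3)[of "3/4"] h'(2)[of "1/4"] by simp
  have in01: "base b \<in> {base0, base1}" for b
    by (cases b) (simp_all add: base_simps)
  have j: "tangential_path (base c) ?j (base e)"
    by (rule tangential_path_join[OF g(1) h(1)]) (rule in01)+
  have hor: "horizontal g F (1/4) (3/4)" "horizontal h G (1/4) (3/4)"
    using F(1)[of "1/4"] G(1)[of "1/4"] by simp_all
  have "horizontal ?j (\<lambda>t. if t \<le> 1/2 then F (2 * t + - 1/4) else G (2 * t + - 3/4) * nc_eps M) (1/4) (3/4)"
  proof (rule horizontal_append)
    have "horizontal (\<lambda>t. g (2 * t + - 1/4)) (\<lambda>t. F (2 * t + - 1/4)) (1/4) (1/2)"
      by (rule horizontal_affine[OF hor(1)]) auto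
    then show "horizontal ?j (\<lambda>t. F (2 * t + - 1/4)) (1/4) (1/2)"
    proof (rule horizontal_cong)
      fix t :: real assume "t \<in> {1/4..1/2}"
      moreover have "g (2 * (1/4) + - 1/4) = fst (base c) + snd (base c) / 4"
        using g'(2)[of "1/4"] by simp
      ultimately show "?j t = g (2 * t + - 1/4)"
        using mid by (cases "t = 1/4"; hypsubst?) (auto simp: tangential_join_eq)
    qed simp
    have "horizontal (\<lambda>t. h (2 * t + - 3/4)) (\<lambda>t. G (2 * t + - 3/4) * nc_eps M) (1/2) (3/4)"
      by (rule horizontal_mult_right, rule horizontal_affine[OF hor(2)]) auto
    then show "horizontal ?j (\<lambda>t. G (2 * t + - 3/4) * nc_eps M) (1/2) (3/4)"
    proof (rule horizontal_cong)
      fix t :: real assume "t \<in> {1/2..3/4}"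
      then show "?j t = h (2 * t + - 3/4)"
        using mid by (cases "t = 1/2"; hypsubst?) (auto simp: tangential_join_eq)
    qed simp
  qed (use F(2)[of "1/4"] G(2)[of "1/4"] in auto)
  then show ?thesis
    by (rule transport_from_middle[OF j])
      (use F(2)[of "1/4"] G(2)[of "1/4"] in \<open>auto simp: nc_eps_mult mult.assoc\<close>)
qed

text \<open>After reversal of time, right multiplication by \<open>M\<close> restores the
  normalization at the new start, because \<open>nc_eps M * M = 1\<close>.\<close>

lemma transport_reverse:
  assumes "transport c g d M"
  shows "transport d (reversepath g) c (nc_eps M)"
proof -
  obtain F where F: "\<And>e. e > 0 \<Longrightarrow> horizontal g F e (1 - e)"
    "\<And>t. 0 < t \<Longrightarrow> t \<le> 1/4 \<Longrightarrow> F t = nc_end c t \<and> F (1 - t) = nc_end d t * nc_eps M"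
    using assms unfolding transport_def by blast
  have "horizontal (reversepath g) (\<lambda>t. F (1 - t) * M) e (1 - e)" if "e > 0" for e
  proof -
    have "horizontal (\<lambda>t. g ((- 1) * t + 1)) (\<lambda>t. F ((- 1) * t + 1)) e (1 - e)"
      by (rule horizontal_affine[OF F(1)[OF that]]) auto
    then show ?thesis
      by (intro horizontal_mult_right) (simp add: reversepath_def[abs_def])
  qed
  moreover have "F (1 - t) * M = nc_end d t \<and> F (1 - (1 - t)) * M = nc_end c t * nc_eps (nc_eps M)"
    if "0 < t" "t \<le> 1/4" for t
    using F(2)[OF that] eps_unitary[OF transport_unitary[OF assms]] by (simp add: mult.assoc)
  ultimately show ?thesis unfolding transport_def by (intro exI[of _ "\<lambda>t. F (1 - t) * M"]) blast
qed

section \<open>Transport along the trivial path, \<open>dch\<close>, \<alpha>, loop powers and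
  conjugates\<close>

lemma transport_trivial: "transport c (tangential_trivial (base c)) c 1"
proof (rule transport_from_middle)
  show "tangential_path (base c) (tangential_trivial (base c)) (base c)"
    by (rule tangential_path_trivial) (cases c; simp add: base_simps)
  have "horizontal (\<lambda>_. fst (base c) + snd (base c) / 4) (\<lambda>_. nc_end c (1/4)) (1/4) (3/4)"
    unfolding horizontal_def
    by (intro conjI exI[of _ "{}"] ballI exI[of _ 0] nc_continuous_on_const)
      (auto simp: nc_has_deriv_def)
  then show "horizontal (tangential_trivial (base c)) (\<lambda>_. nc_end c (1/4)) (1/4) (3/4)"
  proof (rule horizontal_cong)
    fix t :: real assume "t \<in> {1/4..3/4}"
    then show "tangential_trivial (base c) t = fst (base c) + snd (base c) / 4"
      by (cases "t = 1/4"; hypsubst?) (auto simp: tangential_trivial_def tangential_close_def)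
  qed simp
qed (simp_all add: nc_eps_one)

text \<open>On the open unit interval the local solutions at 0 and at 1 are both defined, so they
  differ by a constant right factor, which their pairing computes.\<close>

lemma ex_transport_dch: "\<exists>M. transport False dch True M"
proof -
  have d: "dch t = of_real t" for t
    by (simp add: dch_def linepath_def scaleR_conv_of_real)
  let ?E = "nc_end False" and ?E' = "\<lambda>t. nc_end True (1 - t)"
  have h: "horizontal dch ?E a b" "horizontal dch ?E' a b" if "0 < a" "b < 1" for a b
    by (intro horizontal_end horizontal_end_reflected; use that in \<open>simp add: d side_def\<close>)+
  define K where "K = nc_eps (?E' (1/2)) * ?E (1/2)"
  have "?E t = ?E' t * K" if t: "0 < t" "t < 1" for t
  proof -
    have "?E' t * nc_eps (?E' t) = 1"
      using eps_unitary[of "nc_eps (?E' t)"] nc_eps_end[of "1 - t"] t by simp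
    moreover have "K = nc_eps (?E' t) * ?E t"
      unfolding K_def
      by (rule horizontal_pairing_const[OF h(2) h(1), of "min t (1/2)" "max t (1/2)"]) (use t in auto)
    ultimately show ?thesis by (simp flip: mult.assoc)
  qed
  then have "transport False dch True (nc_eps K)"
    unfolding transport_def
    by (intro exI[of _ "nc_end False"]) (auto intro: h)
  then show ?thesis by blast
qed

lemma transport_alpha: "transport True loop_alpha True (nc_exp (2 * of_real pi * \<i>) True)"
proof (rule transport_from_middle)
  show "tangential_path (base True) loop_alpha (base True)"
    by (simp add: base_simps tangential_path_alpha)
  \<comment> \<open>The logarithm of the local coordinate on the circle of radius 1/4: its imaginary
    part runs from 0 to 2 pi as \<open>t\<close> runs from 1/4 to 3/4. The angle starts at 0 rather
    than pi because \<open>side True\<close> is -1.\<close>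
  define l where "l t = of_real (ln (1/4)) + \<i> * of_real (2 * pi * (2 * t - 1/2))" for t
  have q: "exp (complex_of_real (ln (1/4))) = 1/4"
    by (simp add: exp_of_real)
  have "horizontal (\<lambda>t. of_bool True + side True * exp (l t))
      (\<lambda>t. nc_local True (exp (l t)) * nc_exp (- l t) True) (1/4) (3/4)"
  proof (rule horizontal_local)
    show "continuous_on {1/4..3/4} l" unfolding l_def by (intro continuous_intros)
    show "(l has_vector_derivative 4 * of_real pi * \<i>) (at t)" for t
      unfolding l_def by (auto intro!: derivative_eq_intros simp: scaleR_conv_of_real)
    show "norm (exp (l t)) < 1" for t
      by (simp add: l_def ln_div)
  qed
  then show "horizontal loop_alpha (\<lambda>t. nc_local True (exp (l t)) * nc_exp (- l t) True) (1/4) (3/4)"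
  proof (rule horizontal_cong)
    fix t :: real assume t: "t \<in> {1/4..3/4}"
    have "part_circlepath 1 (1/4) pi (3 * pi) (2 * t - 1/2) = 1 - exp (l t)"
    proof -
      have "exp (\<i> * of_real (linepath pi (3 * pi) (2 * t - 1/2))) =
          exp (of_real pi * \<i> + \<i> * of_real (2 * pi * (2 * t - 1/2)))"
        by (simp add: linepath_def algebra_simps)
      also have "\<dots> = - exp (\<i> * of_real (2 * pi * (2 * t - 1/2)))"
        by (simp only: exp_add exp_pi_i) simp
      finally show ?thesis
        by (simp add: part_circlepath_def l_def exp_add q)
    qed
    then show "loop_alpha t = of_bool True + side True * exp (l t)"
      using t by (cases "t = 1/4"; hypsubst?) (auto simp: loop_alpha_def tangential_close_def base1_def side_def l_def q)
  qed simp
  have l1: "l (1/4) = of_real (ln (1/4))" by (simp add: l_def)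
  have l2: "l (3/4) = of_real (ln (1/4)) + 2 * of_real pi * \<i>" by (simp add: l_def)
  have e1: "exp (l (1/4)) = of_real (1/4)" "exp (l (3/4)) = of_real (1/4)"
    by (simp_all only: l1 l2 exp_add exp_two_pi_i q) simp_all
  show "nc_local True (exp (l (1/4))) * nc_exp (- l (1/4)) True = nc_end True (1/4)"
    by (simp only: e1) (simp only: l1 nc_end_def)
  \<comment> \<open>P returns to its initial value; only the logarithm has grown, and the increment
    2 pi i is the monodromy.\<close>
  have "- l (3/4) = - of_real (ln (1/4)) + - (2 * of_real pi * \<i>)" by (simp add: l2)
  then show "nc_local True (exp (l (3/4))) * nc_exp (- l (3/4)) True =
      nc_end True (1/4) * nc_eps (nc_exp (2 * of_real pi * \<i>) True)"
    by (simp only: e1 nc_end_def nc_exp_add nc_eps_exp mult.assoc)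
qed

text \<open>Exponents add under composition, and \<epsilon> negates them under reversal, which
  accounts for negative \<open>n\<close>.\<close>

lemma transport_loop_power:
  assumes g: "tangential_path (base c) g (base c)" "transport c g c (nc_exp T a)"
  shows "transport c (loop_power (base c) g n) c (nc_exp (of_int n * T) a)"
proof -
  define h where "h = (if 0 \<le> n then g else reversepath g)"
  define T' where "T' = (if 0 \<le> n then T else - T)"
  have h: "tangential_path (base c) h (base c)" "transport c h c (nc_exp T' a)"
    using g tangential_path_reverse[OF g(1)] transport_reverse[OF g(2)]
    by (simp_all add: h_def T'_def nc_eps_exp)
  have c01: "base c \<in> {base0, base1}" by (cases c) (simp_all add: base_simps)
  let ?p = "\<lambda>m. ((\<lambda>k. tangential_join (base c) k h (base c)) ^^ m) (tangential_trivial (base c))"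
  have "tangential_path (base c) (?p m) (base c) \<and> transport c (?p m) c (nc_exp (of_nat m * T') a)" for m
  proof (induction m)
    case 0
    show ?case using tangential_path_trivial[OF c01] transport_trivial by simp
  next
    case (Suc m)
    have "of_nat (Suc m) * T' = of_nat m * T' + T'" by (simp add: algebra_simps)
    then show ?case
      using tangential_path_join[OF _ h(1) c01 c01] transport_join[OF _ _ h] Suc by (simp add: nc_exp_add)
  qed
  from this[of "nat \<bar>n\<bar>"] have "transport c (?p (nat \<bar>n\<bar>)) c (nc_exp (of_nat (nat \<bar>n\<bar>) * T') a)" by blast
  moreover have "of_nat (nat \<bar>n\<bar>) * T' = of_int n * T" by (auto simp: T'_def of_nat_nat)
  ultimately show ?thesis by (simp add: loop_power_def h_def)
qed

lemma transport_conjugate: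
  assumes g: "tangential_path (base c) g (base d)" "transport c g d M"
    and h: "tangential_path (base d) h (base d)" "transport d h d N"
  shows "transport c (tangential_join (base c) (tangential_join (base c) g h (base d)) (reversepath g) (base c)) c
    (M * N * nc_eps M)"
proof -
  have in01: "base b \<in> {base0, base1}" for b
    by (cases b) (simp_all add: base_simps)
  show ?thesis
    by (intro transport_join[OF _ transport_join[OF g h]] tangential_path_join[OF g(1) h(1)]
        tangential_path_reverse g transport_reverse in01)
qed

section \<open>The reflection formula for the series \<open>\<Gamma>\<^sub>1\<close>\<close>

text \<open>Both sides are the expansion of sin(pi z) / pi. The Gamma function is matched with
  \<open>Gamma1\<close> by comparing logarithmic derivatives as formal series.\<close>

lemma Gamma1_reflection:
  "inverse (Gamma1 oo - fps_X) * fps_X * (inverse (Gamma1 oo - fps_X) oo - fps_X) =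
     fps_const (1 / (2 * of_real pi * \<i>)) * (fps_exp (of_real pi * \<i>) - fps_exp (- (of_real pi * \<i>)))"
proof -
  define Z :: "complex fps" where
    "Z = Abs_fps (\<lambda>k. if 2 \<le> k then (\<Sum>n. 1 / of_nat (Suc n) ^ k) / of_nat k * (-1) ^ k else 0)"
  have Z0: "fps_nth Z 0 = 0" by (simp add: Z_def)
  have G: "Gamma1 = fps_exp 1 oo Z" by (simp add: Gamma1_def Z_def)
  have G0: "fps_nth Gamma1 0 = 1" by (simp add: G)
  define R where "R = fps_expansion rGamma (1::complex)"
  define P where "P = fps_expansion Digamma (1::complex)"
  have R: "(\<lambda>z. rGamma (1 + z)) has_fps_expansion R"
    unfolding R_def by (rule analytic_at_imp_has_fps_expansion) (auto intro: analytic_intros)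
  have one: "(1::complex) \<notin> \<int>\<^sub>\<le>\<^sub>0" by simp
  have P: "(\<lambda>z. Digamma (1 + z)) has_fps_expansion P"
    unfolding P_def by (rule analytic_at_imp_has_fps_expansion) (auto intro!: analytic_on_Polygamma)
  \<comment> \<open>This is the value of \<open>Digamma\<close> at 1, the negative of the Euler
    constant.\<close>
  define c where "c = fps_nth P 0"
  \<comment> \<open>Apart from the constant term, the Taylor coefficients of \<open>Digamma\<close>
    at 1 are zeta values up to sign.\<close>
  have ZP: "fps_deriv Z = P - fps_const c"
  proof (rule fps_ext)
    fix n
    show "fps_nth (fps_deriv Z) n = fps_nth (P - fps_const c) n"
    proof (cases "n = 0")
      case False
      have "fps_nth P n = Polygamma n 1 / fact n"
        by (simp add: P_def fps_expansion_def higher_deriv_Polygamma[OF one])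
      also have "\<dots> = (-1) ^ Suc n * (\<Sum>k. inverse ((1 + of_nat k) ^ Suc n))"
        using False by (simp add: Polygamma_def)
      also have "\<dots> = of_nat (Suc n) * fps_nth Z (Suc n)"
        using False by (simp add: Z_def inverse_eq_divide del: of_nat_Suc) (simp add: add_ac)
      finally show ?thesis using False by simp
    qed (simp add: Z_def c_def)
  qed
  have GP: "fps_deriv Gamma1 = Gamma1 * (P - fps_const c)"
    unfolding G by (simp add: fps_compose_deriv Z0 ZP)
  have RP: "fps_deriv R = - (R * P)"
  proof (rule fps_expansion_unique_complex)
    show "deriv (\<lambda>z. rGamma (1 + z)) has_fps_expansion fps_deriv R"
      by (rule has_fps_expansion_deriv[OF R])
    have ev: "eventually (\<lambda>z. - (rGamma (1 + z) * Digamma (1 + z)) = deriv (\<lambda>z. rGamma (1 + z)) z) (nhds (0::complex))"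
    proof -
      have "eventually (\<lambda>z::complex. z \<in> ball 0 1) (nhds 0)"
        by (rule eventually_nhds_in_open) auto
      then show ?thesis
      proof eventually_elim
        case (elim z)
        have "1 + z \<notin> \<int>\<^sub>\<le>\<^sub>0"
        proof
          assume "1 + z \<in> \<int>\<^sub>\<le>\<^sub>0"
          then obtain n where "1 + z = - of_nat n" by (auto elim: nonpos_Ints_cases')
          then have "z = - of_nat n - 1" by (simp add: eq_diff_eq add.commute)
          then have "z = - of_nat (Suc n)" by simp
          then have "norm z = real (Suc n)" by (simp only: norm_minus_cancel norm_of_nat)
          with elim show False by simp
        qed
        then have "((\<lambda>z. rGamma (1 + z)) has_field_derivative - rGamma (1 + z) * Digamma (1 + z)) (at z)"
          by (auto intro!: derivative_eq_intros)
        from DERIV_imp_deriv[OF this] show ?case by simp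
      qed
    qed
    have "(\<lambda>z. - (rGamma (1 + z) * Digamma (1 + z))) has_fps_expansion - (R * P)"
      by (intro fps_expansion_intros R P)
    then show "deriv (\<lambda>z. rGamma (1 + z)) has_fps_expansion - (R * P)"
      using has_fps_expansion_cong[OF ev refl] by blast
  qed
  \<comment> \<open>The logarithmic derivatives of the three factors are -P, P - c and c, so the
    product is constant.\<close>
  have RG: "R * Gamma1 * fps_exp c = 1"
  proof -
    have "fps_deriv (R * Gamma1 * fps_exp c) = 0"
      by (simp add: RP GP) (simp add: algebra_simps)
    then have "R * Gamma1 * fps_exp c = fps_const (fps_nth (R * Gamma1 * fps_exp c) 0)"
      by (rule fps_deriv_eq_0_iff[THEN iffD1])
    then show ?thesis
      by (simp add: R_def fps_expansion_def G0)
  qed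
  let ?m = "- fps_X :: complex fps"
  have mm: "(f oo ?m) oo ?m = f" for f :: "complex fps"
    by (simp add: fps_compose_uminus' fps_eq_iff flip: mult.assoc power_mult_distrib)
  have RG': "(R oo ?m) * (Gamma1 oo ?m) * fps_exp (- c) = 1"
  proof -
    have "(R * Gamma1 * fps_exp c) oo ?m = (R oo ?m) * (Gamma1 oo ?m) * (fps_exp c oo ?m)"
      by (simp add: fps_compose_mult_distrib)
    moreover have "fps_exp c oo ?m = fps_exp (- c)"
      by (simp add: fps_compose_uminus' fps_eq_iff power_minus[of c])
    ultimately show ?thesis using RG by simp
  qed
  have e: "fps_exp c * fps_exp (- c) = 1"
    by (simp flip: fps_exp_add_mult)
  have nz: "fps_nth (Gamma1 oo ?m) 0 \<noteq> 0" by (simp add: G0)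
  have iG: "inverse Gamma1 = R * fps_exp c"
    by (rule fps_inverse_unique) (use RG in \<open>simp add: mult_ac\<close>)
  have iG': "inverse (Gamma1 oo ?m) = (R oo ?m) * fps_exp (- c)"
    by (rule fps_inverse_unique) (use RG' in \<open>simp add: mult_ac\<close>)
  have iG'': "inverse (Gamma1 oo ?m) oo ?m = inverse Gamma1"
    using fps_inverse_compose[of ?m "Gamma1 oo ?m"] nz by (simp add: mm)
  \<comment> \<open>The exponential factors at X and -X cancel, which leaves the reciprocals of
    Gamma(1 + z) and Gamma(1 - z).\<close>
  have "inverse (Gamma1 oo - fps_X) * fps_X * (inverse (Gamma1 oo - fps_X) oo - fps_X)
    = fps_X * (R * (R oo ?m)) * (fps_exp c * fps_exp (- c))"
    unfolding iG'' iG unfolding iG' by (simp add: mult_ac)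
  also have "\<dots> = fps_X * (R * (R oo ?m))" by (simp add: e)
  also have "\<dots> = fps_const (1 / (2 * of_real pi * \<i>)) * (fps_exp (of_real pi * \<i>) - fps_exp (- (of_real pi * \<i>)))"
  proof (rule fps_expansion_unique_complex)
    have "(\<lambda>z. - z) has_fps_expansion ?m"
      by (intro fps_expansion_intros)
    from has_fps_expansion_compose[OF R this]
    have "(\<lambda>z. rGamma (1 - z)) has_fps_expansion (R oo ?m)"
      by (simp add: o_def)
    then show "(\<lambda>z. z * (rGamma (1 + z) * rGamma (1 - z))) has_fps_expansion fps_X * (R * (R oo ?m))"
      by (intro fps_expansion_intros R)
    have "z * (rGamma (1 + z) * rGamma (1 - z)) =
        1 / (2 * of_real pi * \<i>) * (exp (of_real pi * \<i> * z) - exp (- (of_real pi * \<i>) * z))" for z :: complex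
    proof -
      \<comment> \<open>Here \<open>z * rGamma (1 + z)\<close> is \<open>rGamma z\<close>, to which
        the reflection formula applies.\<close>
      have "z * (rGamma (1 + z) * rGamma (1 - z)) = sin (of_real pi * z) / of_real pi"
        using rGamma_plus1[of z] rGamma_reflection_complex[of z] by (simp add: add_ac mult.assoc[symmetric])
      also have "\<dots> = 1 / (2 * of_real pi * \<i>) * (exp (of_real pi * \<i> * z) - exp (- (of_real pi * \<i>) * z))"
        by (simp add: sin_exp_eq mult_ac)
      finally show ?thesis .
    qed
    then show "(\<lambda>z. z * (rGamma (1 + z) * rGamma (1 - z))) has_fps_expansion
        fps_const (1 / (2 * of_real pi * \<i>)) * (fps_exp (of_real pi * \<i>) - fps_exp (- (of_real pi * \<i>)))"
      by (simp only:) (intro fps_expansion_intros)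
  qed
  finally show ?thesis .
qed

section \<open>The generating series\<close>

definition Phi_dch :: "complex ncps" where
  "Phi_dch = Abs_ncps (\<lambda>w. reg_integral dch (map of_bool w))"

text \<open>Some transport matrix exists, and the coefficients of any such matrix are the
  regularized integrals.\<close>

lemma transport_dch: "transport False dch True Phi_dch"
proof -
  obtain M where M: "transport False dch True M" using ex_transport_dch by blast
  then have "Phi_dch = M"
    by (intro ncps_eqI) (simp add: Phi_dch_def reg_integral_transport)
  with M show ?thesis by simp
qed

lemma Phi_sh_eq: "Phi_sh T = Phi_dch * nc_exp (- T) True"
  by (simp add: Phi_sh_def Phi_dch_def nc_exp_def)

lemma transport_beta_n:
  "transport False (loop_beta_n n) False (Phi_dch * nc_exp (2 * of_real pi * \<i> * of_int n) True * nc_eps Phi_dch)"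
proof -
  have alpha: "tangential_path (base True) loop_alpha (base True)"
    by (simp add: base_simps tangential_path_alpha)
  have "transport True (loop_power (base True) loop_alpha n) True (nc_exp (of_int n * (2 * of_real pi * \<i>)) True)"
    by (rule transport_loop_power[OF alpha transport_alpha])
  moreover have "tangential_path (base True) (loop_power (base True) loop_alpha n) (base True)"
    by (rule tangential_path_power[OF _ alpha]) (simp add: base_simps)
  moreover have "tangential_path (base False) dch (base True)"
    by (simp add: base_simps tangential_path_dch)
  ultimately show ?thesis
    unfolding loop_beta_n_def base_simps[symmetric]
    using transport_conjugate[OF _ transport_dch] by (simp add: mult.commute)
qed

lemma transport_beta:
  "transport False loop_beta False (Phi_dch * nc_exp (2 * of_real pi * \<i>) True * nc_eps Phi_dch)"
  unfolding loop_beta_def base_simps[symmetric]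
  by (intro transport_conjugate transport_dch transport_alpha)
    (simp_all add: base_simps tangential_path_alpha tangential_path_dch)

text \<open>At T = 2 pi i n this is the transport along \<open>loop_beta_n n\<close>. Each
  coefficient of the right-hand side is a polynomial in T, and these infinitely many values
  determine it.\<close>

lemma Phi_L_eq: "Phi_L T = Phi_dch * nc_exp T True * nc_eps Phi_dch"
proof (rule ncps_eqI)
  fix w
  \<comment> \<open>\<open>q v\<close> is the coefficient of exp(T X1) at \<open>v\<close>, as a
    polynomial in T.\<close>
  define q where "q v = (if set v \<subseteq> {True} then monom (1 / fact (length v)) (length v) else 0 :: complex poly)" for v
  define p where "p = (\<Sum>k\<le>length w. (\<Sum>j\<le>k. smult (nc_coeff Phi_dch (take j (take k w)))
      (q (drop j (take k w)))) * [:nc_coeff (nc_eps Phi_dch) (drop k w):])"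
  have q: "poly (q v) T = nc_coeff (nc_exp T True) v" for v T
    by (simp add: q_def nc_coeff_exp poly_monom)
  have p: "poly p T = nc_coeff (Phi_dch * nc_exp T True * nc_eps Phi_dch) w" for T
    unfolding p_def nc_coeff_mult
    by (auto simp: poly_sum q min_def intro!: sum.cong)
  have L: "L_n n w = poly p (2 * of_real pi * \<i> * of_int n)" for n
    unfolding p L_n_def by (rule reg_integral_transport[OF transport_beta_n])
  have "L_poly w = p"
    unfolding L_poly_def
  proof (rule the_equality)
    fix p' assume p': "\<forall>n. L_n n w = poly p' (2 * of_real pi * \<i> * of_int n)"
    have "range (\<lambda>n::int. 2 * of_real pi * \<i> * of_int n) \<subseteq> {x. poly (p' - p) x = 0}"
      using p' L by auto
    moreover have "infinite (range (\<lambda>n::int. 2 * of_real pi * \<i> * of_int n :: complex))"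
      by (subst finite_image_iff) (auto simp: inj_on_def infinite_UNIV_int)
    ultimately have "p' - p = 0"
      using poly_roots_finite[of "p' - p"] finite_subset by blast
    then show "p' = p" by simp
  qed (simp add: L)
  then show "nc_coeff (Phi_L T) w = nc_coeff (Phi_dch * nc_exp T True * nc_eps Phi_dch) w"
    by (simp add: Phi_L_def p)
qed

section \<open>The identities between the generating series\<close>

lemma Phi_sh_S_eq:
  "Phi_sh_S T1 T2 = Phi_dch * (nc_var True * nc_exp (- T1 + T2) True) * nc_eps Phi_dch"
proof -
  \<comment> \<open>\<epsilon> turns exp(-T2 X1) into exp(T2 X1), and X1 commutes with its own
    exponential.\<close>
  have "Phi_sh_S T1 T2 = Phi_dch * (nc_exp (- T1) True * nc_var True) * nc_exp T2 True * nc_eps Phi_dch"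
    by (simp add: Phi_sh_S_def Phi_sh_eq nc_eps_mult nc_eps_exp mult.assoc)
  then show ?thesis
    by (simp only: nc_var_exp[symmetric] nc_exp_add mult.assoc)
qed

text \<open>Only the difference of the two arguments of \<open>Phi_sh_S\<close> matters; a free
  \<open>T1\<close> lets this serve both the derivative formula and the integral from 0.\<close>

lemma Phi_L_coeff_deriv:
  "((\<lambda>T. nc_coeff (Phi_L T) w) has_field_derivative nc_coeff (Phi_sh_S T1 (T1 + T)) w) (at T)"
proof -
  have *: "((\<lambda>T. nc_coeff (nc_exp T True) v) has_field_derivative nc_coeff (nc_var True * nc_exp T True) v) (at T)" for v
  proof (cases v)
    case (Cons b u)
    have "((\<lambda>z. z ^ Suc n / fact (Suc n)) has_field_derivative (T ^ n / fact n)) (at T)" for n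
      by (rule DERIV_cong[OF DERIV_cdivide[OF DERIV_power[OF DERIV_ident, of "Suc n"]]])
        (simp del: of_nat_Suc)
    from this[of "length u"] show ?thesis
      by (auto simp: Cons nc_coeff_exp nc_coeff_var_mult simp del: fact_Suc power_Suc)
  qed (simp add: nc_coeff_exp)
  have "- T1 + (T1 + T) = T" by simp
  then show ?thesis
    unfolding Phi_sh_S_eq Phi_L_eq nc_coeff_mult[of _ _ w] nc_coeff_mult[of Phi_dch]
    by (auto intro!: DERIV_sum DERIV_cmult_right DERIV_cmult *)
qed

text \<open>The two Gamma factors stand on either side of X1, so the reflection formula turns the
  middle into a difference of exponentials, which shift the argument of \<open>Phi_L\<close> by pi i
  and -pi i.\<close>

lemma Phi_st_S_eq:
  "Phi_st_S T1 T2 = nc_scale (1 / (2 * of_real pi * \<i>))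
     (Phi_L (of_real pi * \<i> - T1 + T2) - Phi_L (- (of_real pi * \<i>) - T1 + T2))"
proof -
  let ?I = "inverse (Gamma1 oo - fps_X)" and ?at = "\<lambda>f. fps_at_var f True :: complex ncps"
  have "Phi_st_S T1 T2 = Phi_dch * ?at (fps_exp (- T1)) * (?at ?I * ?at fps_X * ?at (?I oo - fps_X)) *
      ?at (fps_exp T2) * nc_eps Phi_dch"
    by (simp add: Phi_st_S_def Phi_st_def Phi_sh_eq nc_eps_mult nc_eps_fps_at_var fps_at_var_X nc_eps_exp mult.assoc)
      (simp add: nc_exp_def)
  also have "?at ?I * ?at fps_X * ?at (?I oo - fps_X) =
      nc_scale (1 / (2 * of_real pi * \<i>)) (nc_exp (of_real pi * \<i>) True - nc_exp (- (of_real pi * \<i>)) True)"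
    by (simp only: fps_at_var_mult[symmetric] Gamma1_reflection)
      (simp only: fps_at_var_const_mult fps_at_var_diff nc_exp_def)
  also have "Phi_dch * ?at (fps_exp (- T1)) * \<dots> * ?at (fps_exp T2) * nc_eps Phi_dch =
     nc_scale (1 / (2 * of_real pi * \<i>))
       (Phi_dch * (nc_exp (- T1) True * nc_exp (of_real pi * \<i>) True * nc_exp T2 True) * nc_eps Phi_dch -
        Phi_dch * (nc_exp (- T1) True * nc_exp (- (of_real pi * \<i>)) True * nc_exp T2 True) * nc_eps Phi_dch)"
    by (simp add: nc_exp_def[symmetric] nc_scale_mult_left nc_scale_mult_right left_diff_distrib right_diff_distrib mult.assoc)
  finally have "Phi_st_S T1 T2 = nc_scale (1 / (2 * of_real pi * \<i>))
     (Phi_L (- T1 + of_real pi * \<i> + T2) - Phi_L (- T1 + - (of_real pi * \<i>) + T2))"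
    by (simp only: Phi_L_eq nc_exp_add)
  moreover have "- T1 + of_real pi * \<i> + T2 = of_real pi * \<i> - T1 + T2"
    "- T1 + - (of_real pi * \<i>) + T2 = - (of_real pi * \<i>) - T1 + T2"
    by simp_all
  ultimately show ?thesis by (simp only:)
qed

lemma Phi_L_0: "Phi_L 0 = 1"
  by (simp add: Phi_L_eq transport_unitary[OF transport_dch])

lemma Phi_RS_eq: "Phi_RS = nc_scale (1 / (2 * of_real pi * \<i>)) (Phi_L (2 * of_real pi * \<i>) - 1)"
proof (rule ncps_eqI)
  fix w
  have beta: "reg_integral loop_beta (map of_bool v) = nc_coeff (Phi_L (2 * of_real pi * \<i>)) v" for v
    unfolding Phi_L_eq by (rule reg_integral_transport[OF transport_beta])
  \<comment> \<open>\<open>Phi_RS\<close> is 0 at the empty word by definition; the right-hand side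
    is 0 there too, because the constant coefficient of \<open>Phi_L T\<close> does not depend on
    \<open>T\<close>.\<close>
  have "nc_coeff (Phi_L (2 * of_real pi * \<i>)) [] = nc_coeff (Phi_L 0) []"
    by (simp add: Phi_L_eq nc_coeff_exp)
  then show "nc_coeff Phi_RS w = nc_coeff (nc_scale (1 / (2 * of_real pi * \<i>)) (Phi_L (2 * of_real pi * \<i>) - 1)) w"
    by (simp add: Phi_RS_def Z_RS_def beta Phi_L_0)
qed

theorem theorem4p1:
  fixes T1 T2 :: complex
  shows "Phi_sh_S T1 T2 = nc_deriv Phi_L (- T1 + T2) \<and>
    Phi_st_S T1 T2 =
      nc_scale (1 / (2 * of_real pi * \<i>))
        (Phi_L (of_real pi * \<i> - T1 + T2) - Phi_L (- (of_real pi * \<i>) - T1 + T2)) \<and>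
    Phi_RS = nc_scale (1 / (2 * of_real pi * \<i>)) (Phi_L (2 * of_real pi * \<i>) - Phi_L 0) \<and>
    Phi_RS = nc_scale (1 / (2 * of_real pi * \<i>)) (Phi_L (2 * of_real pi * \<i>) - 1) \<and>
    Phi_RS = nc_scale (1 / (2 * of_real pi * \<i>))
      (nc_contour_integral (linepath 0 (2 * of_real pi * \<i>)) (\<lambda>T. Phi_sh_S 0 T)) \<and>
    Phi_RS = Phi_st_S (- (of_real pi * \<i>) / 2) (of_real pi * \<i> / 2)"
proof (intro conjI)
  show "Phi_sh_S T1 T2 = nc_deriv Phi_L (- T1 + T2)"
  proof (rule ncps_eqI)
    fix w
    from DERIV_imp_deriv[OF Phi_L_coeff_deriv[of w T1 "- T1 + T2"]]
    show "nc_coeff (Phi_sh_S T1 T2) w = nc_coeff (nc_deriv Phi_L (- T1 + T2)) w"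
      by (simp add: nc_deriv_def)
  qed
  show "Phi_RS = nc_scale (1 / (2 * of_real pi * \<i>))
      (nc_contour_integral (linepath 0 (2 * of_real pi * \<i>)) (\<lambda>T. Phi_sh_S 0 T))"
  proof -
    have "contour_integral (linepath 0 (2 * of_real pi * \<i>)) (\<lambda>T. nc_coeff (Phi_sh_S 0 T) w) =
        nc_coeff (Phi_L (2 * of_real pi * \<i>) - 1) w" for w
    proof (rule contour_integral_unique)
      \<comment> \<open>Each coefficient of \<open>Phi_L\<close> is a primitive of the integrand on
        the whole plane, so the integral is its increment.\<close>
      have "((\<lambda>T. nc_coeff (Phi_L T) w) has_field_derivative nc_coeff (Phi_sh_S 0 T) w) (at T)" for T
        using Phi_L_coeff_deriv[of w 0 T] by simp
      from contour_integral_primitive[of UNIV, OF this]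
      show "((\<lambda>T. nc_coeff (Phi_sh_S 0 T) w) has_contour_integral
          nc_coeff (Phi_L (2 * of_real pi * \<i>) - 1) w) (linepath 0 (2 * of_real pi * \<i>))"
        by (metis Phi_L_0 nc_coeff_simps(4) pathfinish_linepath pathstart_linepath subset_UNIV valid_path_linepath)
    qed
    then have "nc_contour_integral (linepath 0 (2 * of_real pi * \<i>)) (\<lambda>T. Phi_sh_S 0 T) = Phi_L (2 * of_real pi * \<i>) - 1"
      by (intro ncps_eqI) (simp only: nc_contour_integral_def nc_coeff_Abs)
    then show ?thesis by (simp only: Phi_RS_eq)
  qed
  \<comment> \<open>With -pi i / 2 and pi i / 2 as arguments, the two shifted arguments of
    \<open>Phi_L\<close> become 2 pi i and 0.\<close>
  have "of_real pi * \<i> - - (of_real pi * \<i>) / 2 + of_real pi * \<i> / 2 = 2 * of_real pi * \<i>"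
    "- (of_real pi * \<i>) - - (of_real pi * \<i>) / 2 + of_real pi * \<i> / 2 = 0"
    by simp_all
  then show "Phi_RS = Phi_st_S (- (of_real pi * \<i>) / 2) (of_real pi * \<i> / 2)"
    by (simp only: Phi_st_S_eq Phi_RS_eq Phi_L_0)
qed (simp_all only: Phi_st_S_eq Phi_RS_eq Phi_L_0)

end
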